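(* Suppose $\rho$ satisfies (C1)--(C4) and is subadditive (P1). Let $L\ge 1$. Then, for any adapted process $H=(H_t)_{t\in\{0,\ldots,T\}}\in\mathcal H$ and each fixed $t\in\{0,\ldots,T\}$ (with $j_0:=t$): (i) one has the dual representation $$Y_t^{*,L}=\inf_{M^{(1)},\ldots,M^{(L)}\in\mathcal M_0^\rho}\ \rho_t\Big(\max_{t\le j_1<j_2<\cdots<j_L}\sum_{k=1}^L\big(H_{j_k}+M^{(k)}_{j_{k-1}}-M^{(k)}_{j_k}\big)\Big);$$ (ii) the infimum is attained: $$Y_t^{*,L}=\rho_t\Big(\max_{t\le j_1<j_2<\cdots<j_L}\sum_{k=1}^L\big(H_{j_k}+M^{*,L-k+1}_{j_{k-1}}-M^{*,L-k+1}_{j_k}\big)\Big);$$ (iii) if in addition $\rho$ is sensitive (P2), then almost surely $$Y_t^{*,L}=\max_{t\le j_1<j_2<\cdots<j_L}\sum_{k=1}^L\big(H_{j_k}+M^{*,L-k+1}_{j_{k-1}}-M^{*,L-k+1}_{j_k}\big).$$ Here the $\rho$-martingales $M^{*,q}\in\mathcal M_0^\rho$, $q=1,\ldots,L$, are given by $$M^{*,q}_{r+1}-M^{*,q}_r=Y^{*,q}_{r+1}-\rho_r\big(Y^{*,q}_{r+1}\big),$$ and $Y^{*,q}$ is the upper Snell envelope due to $q$ exercise rights, which satisfies the Bellman principle $$Y^{*,q}_r=\max\big[H_r+\rho_r\big(Y^{*,q-1}_{r+1}\big),\ \rho_r\big(Y^{*,q}_{r+1}\big)\big].$$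
   Context: $(\Omega,(\mathcal F_t)_{t\in\{0,\ldots,T\}},\mathbb P)$ is a filtered probability space, $\mathcal F=\mathcal F_T$. $\mathfrak X$ is a linear subspace of $L^0(\Omega,\mathcal F,\mathbb P)$, closed under $\wedge$ and $\vee$ and containing all indicators $1_A$, $A\in\mathcal F$. All (in)equalities between random variables are $\mathbb P$-a.s.; $X\in\mathcal F_t$ means $X$ is $\mathcal F_t$-measurable; random variables to which $\rho_t$ is applied are understood to lie in $\mathfrak X$. $\rho=(\rho_t)_{t=0,\ldots,T}$ is a family of maps $\rho_t:\mathfrak X\to\mathfrak X\cap L^0(\Omega,\mathcal F_t,\mathbb P)$. For all $X,Y\in\mathfrak X$ and all $t$: (C1) $X\le Y\Rightarrow\rho_t(X)\le\rho_t(Y)$; (C2) $\rho_t(1_AX)=1_A\rho_t(X)$ for $A\in\mathcal F_t$; (C3) $\rho_t=\rho_t\circ\rho_{t+1}$ for $t\le T-1$; (C4) $\rho_t(X+Y)=\rho_t(X)+Y$ if $Y\in\mathcal F_t$; (P1) $\rho_t(X+Y)\le\rho_t(X)+\rho_t(Y)$; (P2) if $X\le0$ and $\rho_t(X)\ge0$, then $X=0$. $\mathcal H$ is the set of adapted processes $(U_t)_{t\in\{0,\ldots,T\}}$ with $U_t\in\mathfrak X\cap L^0(\Omega,\mathcal F_t,\mathbb P)$. A $\rho$-martingale is $M\in\mathcal H$ with $M_t=\rho_t(M_{t+1})$ for $0\le t<T$; $\mathcal M_0^\rho$ is the set of $\rho$-martingales with $M_0=0$. Convention beyond the horizon: $H_j:=0$,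 $\mathcal F_j:=\mathcal F_T$, $\rho_j:=\rho_T$ for $j>T$, so that rights not exercised by time $T$ are valueless, and $M_j=M_T$ for $j>T$ for each $\rho$-martingale $M$. The indices $j_k$ range over integers (possibly exceeding $T$). For $q\ge1$, $Y_t^{*,q}:=\operatorname{ess\,sup}\rho_t\big(\sum_{l=1}^qH_{\tau_l}\big)$, the supremum being over vectors of integer-valued stopping times $(\tau_1,\ldots,\tau_q)$ with $\tau_1\ge t$ and $\tau_l\ge\tau_{l-1}+1$ for $1<l\le q$ (values beyond $T$ allowed, with $H_j=0$ and $\mathcal F_j=\mathcal F_T$ for $j>T$); $Y^{*,0}:=0$, and $Y^{*,q}_r=0$ for $r>T$. The infimum in (i) is an essential infimum. *)

theory Defs
  imports "HOL-Probability.Probability"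
begin

section \<open>Setting\<close>

text \<open>
  Elements of $L^0$ are represented by measurable functions. Every notion below is invariant under
  changes on null sets, so that it is a notion about equivalence classes. In particular, membership
  in $L^0$ of a sub-sigma-algebra \<open>G\<close> means having a \<open>G\<close>-measurable version; the sigma-algebras are
  not assumed to be complete.
\<close>

definition L0 :: "'a measure \<Rightarrow> 'a measure \<Rightarrow> ('a \<Rightarrow> real) set" where
  "L0 P G = {X \<in> borel_measurable P. \<exists>X' \<in> borel_measurable G. AE \<omega> in P. X \<omega> = X' \<omega>}"

text \<open>
  Continuation of a family indexed by \<open>{0..T}\<close> beyond the horizon by its value at \<open>T\<close>
  (used for filtrations and for martingales); only the values at indices up to \<open>T\<close> matter.
\<close>

definition freeze :: "nat \<Rightarrow> (nat \<Rightarrow> 'b) \<Rightarrow> nat \<Rightarrow> 'b" where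
  "freeze T f j = f (min j T)"

locale dynamic_setting = prob_space P
  for P :: "'a measure" +
  fixes F :: "nat \<Rightarrow> 'a measure"
    and T :: nat
    and \<XX> :: "('a \<Rightarrow> real) set"
    and \<rho> :: "nat \<Rightarrow> ('a \<Rightarrow> real) \<Rightarrow> ('a \<Rightarrow> real)"
  assumes filtration: "filtration (space P) (freeze T F)"
    and sets_F_T: "sets (F T) = sets P"
    and X_measurable: "\<XX> \<subseteq> borel_measurable P"
    and X_AE_closed:
      "\<And>X Y. X \<in> \<XX> \<Longrightarrow> Y \<in> borel_measurable P \<Longrightarrow> AE \<omega> in P. X \<omega> = Y \<omega> \<Longrightarrow> Y \<in> \<XX>"
    and X_add: "\<And>X Y. X \<in> \<XX> \<Longrightarrow> Y \<in> \<XX> \<Longrightarrow> (\<lambda>\<omega>. X \<omega> + Y \<omega>) \<in> \<XX>"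
    and X_scale: "\<And>c X. X \<in> \<XX> \<Longrightarrow> (\<lambda>\<omega>. c * X \<omega>) \<in> \<XX>"
    and X_min: "\<And>X Y. X \<in> \<XX> \<Longrightarrow> Y \<in> \<XX> \<Longrightarrow> (\<lambda>\<omega>. min (X \<omega>) (Y \<omega>)) \<in> \<XX>"
    and X_max: "\<And>X Y. X \<in> \<XX> \<Longrightarrow> Y \<in> \<XX> \<Longrightarrow> (\<lambda>\<omega>. max (X \<omega>) (Y \<omega>)) \<in> \<XX>"
    and X_indicator: "\<And>A. A \<in> sets P \<Longrightarrow> indicator A \<in> \<XX>"
    and rho_range: "\<And>t X. t \<le> T \<Longrightarrow> X \<in> \<XX> \<Longrightarrow> \<rho> t X \<in> \<XX> \<inter> L0 P (F t)"
    and rho_AE_cong: "\<And>t X Y. t \<le> T \<Longrightarrow> X \<in> \<XX> \<Longrightarrow> Y \<in> \<XX> \<Longrightarrow> AE \<omega> in P. X \<omega> = Y \<omega>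
      \<Longrightarrow> AE \<omega> in P. \<rho> t X \<omega> = \<rho> t Y \<omega>"


section \<open>Properties of the functionals\<close>

definition monotone_functional ::
    "'a measure \<Rightarrow> nat \<Rightarrow> ('a \<Rightarrow> real) set \<Rightarrow> (nat \<Rightarrow> ('a \<Rightarrow> real) \<Rightarrow> ('a \<Rightarrow> real)) \<Rightarrow> bool" where
  "monotone_functional P T \<XX> \<rho> \<longleftrightarrow> (\<forall>t\<le>T. \<forall>X\<in>\<XX>. \<forall>Y\<in>\<XX>.
     (AE \<omega> in P. X \<omega> \<le> Y \<omega>) \<longrightarrow> (AE \<omega> in P. \<rho> t X \<omega> \<le> \<rho> t Y \<omega>))"

text \<open>
  The identity $\rho_t(1_A X) = 1_A \rho_t(X)$ for all $X$ in the domain presupposes that $1_A X$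
  again belongs to the domain. This does not follow from the closure properties of the domain
  and is therefore spelled out.
\<close>

definition local_functional ::
    "'a measure \<Rightarrow> (nat \<Rightarrow> 'a measure) \<Rightarrow> nat \<Rightarrow> ('a \<Rightarrow> real) set \<Rightarrow> (nat \<Rightarrow> ('a \<Rightarrow> real) \<Rightarrow> ('a \<Rightarrow> real)) \<Rightarrow> bool" where
  "local_functional P F T \<XX> \<rho> \<longleftrightarrow> (\<forall>t\<le>T. \<forall>X\<in>\<XX>. \<forall>A\<in>sets (F t).
     (\<lambda>\<omega>. indicator A \<omega> * X \<omega>) \<in> \<XX> \<and>
     (AE \<omega> in P. \<rho> t (\<lambda>\<omega>. indicator A \<omega> * X \<omega>) \<omega> = indicator A \<omega> * \<rho> t X \<omega>))"

definition time_consistent_functional ::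
    "'a measure \<Rightarrow> nat \<Rightarrow> ('a \<Rightarrow> real) set \<Rightarrow> (nat \<Rightarrow> ('a \<Rightarrow> real) \<Rightarrow> ('a \<Rightarrow> real)) \<Rightarrow> bool" where
  "time_consistent_functional P T \<XX> \<rho> \<longleftrightarrow> (\<forall>t<T. \<forall>X\<in>\<XX>.
     AE \<omega> in P. \<rho> t X \<omega> = \<rho> t (\<rho> (t + 1) X) \<omega>)"

definition translation_invariant_functional ::
    "'a measure \<Rightarrow> (nat \<Rightarrow> 'a measure) \<Rightarrow> nat \<Rightarrow> ('a \<Rightarrow> real) set \<Rightarrow> (nat \<Rightarrow> ('a \<Rightarrow> real) \<Rightarrow> ('a \<Rightarrow> real)) \<Rightarrow> bool" where
  "translation_invariant_functional P F T \<XX> \<rho> \<longleftrightarrow> (\<forall>t\<le>T. \<forall>X\<in>\<XX>. \<forall>Y\<in>\<XX> \<inter> L0 P (F t).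
     AE \<omega> in P. \<rho> t (\<lambda>\<omega>. X \<omega> + Y \<omega>) \<omega> = \<rho> t X \<omega> + Y \<omega>)"

definition subadditive_functional ::
    "'a measure \<Rightarrow> nat \<Rightarrow> ('a \<Rightarrow> real) set \<Rightarrow> (nat \<Rightarrow> ('a \<Rightarrow> real) \<Rightarrow> ('a \<Rightarrow> real)) \<Rightarrow> bool" where
  "subadditive_functional P T \<XX> \<rho> \<longleftrightarrow> (\<forall>t\<le>T. \<forall>X\<in>\<XX>. \<forall>Y\<in>\<XX>.
     AE \<omega> in P. \<rho> t (\<lambda>\<omega>. X \<omega> + Y \<omega>) \<omega> \<le> \<rho> t X \<omega> + \<rho> t Y \<omega>)"

definition sensitive_functional ::
    "'a measure \<Rightarrow> nat \<Rightarrow> ('a \<Rightarrow> real) set \<Rightarrow> (nat \<Rightarrow> ('a \<Rightarrow> real) \<Rightarrow> ('a \<Rightarrow> real)) \<Rightarrow> bool" where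
  "sensitive_functional P T \<XX> \<rho> \<longleftrightarrow> (\<forall>t\<le>T. \<forall>X\<in>\<XX>.
     (AE \<omega> in P. X \<omega> \<le> 0) \<longrightarrow> (AE \<omega> in P. \<rho> t X \<omega> \<ge> 0) \<longrightarrow> (AE \<omega> in P. X \<omega> = 0))"


section \<open>Processes and martingales\<close>

definition adapted_processes ::
    "'a measure \<Rightarrow> (nat \<Rightarrow> 'a measure) \<Rightarrow> nat \<Rightarrow> ('a \<Rightarrow> real) set \<Rightarrow> (nat \<Rightarrow> 'a \<Rightarrow> real) set" where
  "adapted_processes P F T \<XX> = {U. \<forall>t\<le>T. U t \<in> \<XX> \<inter> L0 P (F t)}"

definition rho_martingales ::
    "'a measure \<Rightarrow> (nat \<Rightarrow> 'a measure) \<Rightarrow> nat \<Rightarrow> ('a \<Rightarrow> real) set \<Rightarrow> (nat \<Rightarrow> ('a \<Rightarrow> real) \<Rightarrow> ('a \<Rightarrow> real)) \<Rightarrow> (nat \<Rightarrow> 'a \<Rightarrow> real) set" where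
  "rho_martingales P F T \<XX> \<rho> =
     {M \<in> adapted_processes P F T \<XX>. \<forall>t<T. AE \<omega> in P. M t \<omega> = \<rho> t (M (t + 1)) \<omega>}"

definition rho_martingales0 ::
    "'a measure \<Rightarrow> (nat \<Rightarrow> 'a measure) \<Rightarrow> nat \<Rightarrow> ('a \<Rightarrow> real) set \<Rightarrow> (nat \<Rightarrow> ('a \<Rightarrow> real) \<Rightarrow> ('a \<Rightarrow> real)) \<Rightarrow> (nat \<Rightarrow> 'a \<Rightarrow> real) set" where
  "rho_martingales0 P F T \<XX> \<rho> =
     {M \<in> rho_martingales P F T \<XX> \<rho>. AE \<omega> in P. M 0 \<omega> = 0}"

definition payoff :: "nat \<Rightarrow> (nat \<Rightarrow> 'a \<Rightarrow> real) \<Rightarrow> nat \<Rightarrow> 'a \<Rightarrow> real" where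
  "payoff T H j \<omega> = (if j \<le> T then H j \<omega> else 0)"


section \<open>Essential suprema and infima of families of random variables\<close>

definition is_ess_sup :: "'a measure \<Rightarrow> ('a \<Rightarrow> real) set \<Rightarrow> ('a \<Rightarrow> ereal) \<Rightarrow> bool" where
  "is_ess_sup P \<S> Z \<longleftrightarrow> Z \<in> borel_measurable P \<and>
     (\<forall>X\<in>\<S>. AE \<omega> in P. ereal (X \<omega>) \<le> Z \<omega>) \<and>
     (\<forall>Z'\<in>borel_measurable P. (\<forall>X\<in>\<S>. AE \<omega> in P. ereal (X \<omega>) \<le> Z' \<omega>) \<longrightarrow>
        (AE \<omega> in P. Z \<omega> \<le> Z' \<omega>))"

definition is_ess_inf :: "'a measure \<Rightarrow> ('a \<Rightarrow> real) set \<Rightarrow> ('a \<Rightarrow> ereal) \<Rightarrow> bool" where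
  "is_ess_inf P \<S> Z \<longleftrightarrow> Z \<in> borel_measurable P \<and>
     (\<forall>X\<in>\<S>. AE \<omega> in P. Z \<omega> \<le> ereal (X \<omega>)) \<and>
     (\<forall>Z'\<in>borel_measurable P. (\<forall>X\<in>\<S>. AE \<omega> in P. Z' \<omega> \<le> ereal (X \<omega>)) \<longrightarrow>
        (AE \<omega> in P. Z' \<omega> \<le> Z \<omega>))"

definition ess_sup :: "'a measure \<Rightarrow> ('a \<Rightarrow> real) set \<Rightarrow> 'a \<Rightarrow> ereal" where
  "ess_sup P \<S> = (SOME Z. is_ess_sup P \<S> Z)"

lemma is_ess_sup_unique:
  assumes "is_ess_sup P \<S> Z" "is_ess_sup P \<S> Z'"
  shows "AE \<omega> in P. Z \<omega> = Z' \<omega>"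
proof -
  have "AE \<omega> in P. Z \<omega> \<le> Z' \<omega>" "AE \<omega> in P. Z' \<omega> \<le> Z \<omega>"
    using assms unfolding is_ess_sup_def by blast+
  then show ?thesis by eventually_elim (rule antisym)
qed


section \<open>The upper Snell envelope for multiple exercise rights\<close>

text \<open>Vectors $(\tau_1,\dots,\tau_q)$ are represented by the values at \<open>1, \<dots>, q\<close> of a function.\<close>

definition exercise_times ::
    "'a measure \<Rightarrow> (nat \<Rightarrow> 'a measure) \<Rightarrow> nat \<Rightarrow> nat \<Rightarrow> nat \<Rightarrow> (nat \<Rightarrow> 'a \<Rightarrow> nat) set" where
  "exercise_times P F T q t = {\<tau>.
     (\<forall>l\<in>{1..q}. stopping_time (freeze T F) (\<tau> l)) \<and>
     (AE \<omega> in P. t \<le> \<tau> 1 \<omega>) \<and>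
     (\<forall>l. 1 < l \<and> l \<le> q \<longrightarrow> (AE \<omega> in P. \<tau> (l - 1) \<omega> + 1 \<le> \<tau> l \<omega>))}"

definition exercise_values ::
    "'a measure \<Rightarrow> (nat \<Rightarrow> 'a measure) \<Rightarrow> nat \<Rightarrow> (nat \<Rightarrow> ('a \<Rightarrow> real) \<Rightarrow> ('a \<Rightarrow> real)) \<Rightarrow> (nat \<Rightarrow> 'a \<Rightarrow> real) \<Rightarrow> nat \<Rightarrow> nat \<Rightarrow> ('a \<Rightarrow> real) set" where
  "exercise_values P F T \<rho> H q t =
     (\<lambda>\<tau>. \<rho> t (\<lambda>\<omega>. \<Sum>l=1..q. payoff T H (\<tau> l \<omega>) \<omega>)) ` exercise_times P F T q t"

definition snell ::
    "'a measure \<Rightarrow> (nat \<Rightarrow> 'a measure) \<Rightarrow> nat \<Rightarrow> (nat \<Rightarrow> ('a \<Rightarrow> real) \<Rightarrow> ('a \<Rightarrow> real)) \<Rightarrow> (nat \<Rightarrow> 'a \<Rightarrow> real) \<Rightarrow> nat \<Rightarrow> nat \<Rightarrow> 'a \<Rightarrow> real" where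
  "snell P F T \<rho> H q t =
     (if q = 0 \<or> t > T then (\<lambda>_. 0)
      else (\<lambda>\<omega>. real_of_ereal (ess_sup P (exercise_values P F T \<rho> H q t) \<omega>)))"

text \<open>Only the values at times up to \<open>T\<close> are used; see \<open>freeze\<close>.\<close>

primrec snell_martingale ::
    "'a measure \<Rightarrow> (nat \<Rightarrow> 'a measure) \<Rightarrow> nat \<Rightarrow> (nat \<Rightarrow> ('a \<Rightarrow> real) \<Rightarrow> ('a \<Rightarrow> real)) \<Rightarrow> (nat \<Rightarrow> 'a \<Rightarrow> real) \<Rightarrow> nat \<Rightarrow> nat \<Rightarrow> 'a \<Rightarrow> real" where
  "snell_martingale P F T \<rho> H q 0 = (\<lambda>_. 0)"
| "snell_martingale P F T \<rho> H q (Suc r) = (\<lambda>\<omega>. snell_martingale P F T \<rho> H q r \<omega> +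
     (snell P F T \<rho> H q (r + 1) \<omega> - \<rho> r (snell P F T \<rho> H q (r + 1)) \<omega>))"


section \<open>The pathwise maximum\<close>

definition exercise_dates :: "nat \<Rightarrow> nat \<Rightarrow> (nat \<Rightarrow> nat) set" where
  "exercise_dates L t =
     {j. j 0 = t \<and> t \<le> j 1 \<and> (\<forall>k. 1 \<le> k \<and> k < L \<longrightarrow> j k < j (k + 1))}"

definition path_value ::
    "nat \<Rightarrow> nat \<Rightarrow> (nat \<Rightarrow> 'a \<Rightarrow> real) \<Rightarrow> (nat \<Rightarrow> nat \<Rightarrow> 'a \<Rightarrow> real) \<Rightarrow> (nat \<Rightarrow> nat) \<Rightarrow> 'a \<Rightarrow> real" where
  "path_value T L H N j \<omega> =
     (\<Sum>k=1..L. payoff T H (j k) \<omega> + freeze T (N k) (j (k - 1)) \<omega> - freeze T (N k) (j k) \<omega>)"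

definition pathwise_max ::
    "nat \<Rightarrow> nat \<Rightarrow> (nat \<Rightarrow> 'a \<Rightarrow> real) \<Rightarrow> nat \<Rightarrow> (nat \<Rightarrow> nat \<Rightarrow> 'a \<Rightarrow> real) \<Rightarrow> 'a \<Rightarrow> real" where
  "pathwise_max T L H t N \<omega> = Max ((\<lambda>j. path_value T L H N j \<omega>) ` exercise_dates L t)"

text \<open>
  There are infinitely many date vectors, but all dates beyond the horizon are equivalent, so that
  only finitely many values occur and the maximum is a genuine one.
\<close>

lemma path_value_truncate:
  "path_value T L H N j \<omega> = path_value T L H N (restrict (\<lambda>k. min (j k) (T + 1)) {..L}) \<omega>"
  unfolding path_value_def
proof (rule sum.cong[OF refl])
  fix k assume "k \<in> {1..L}"
  then have [simp]: "k \<in> {..L}" "k - 1 \<in> {..L}" by auto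
  show "payoff T H (j k) \<omega> + freeze T (N k) (j (k - 1)) \<omega> - freeze T (N k) (j k) \<omega> =
      payoff T H (restrict (\<lambda>k. min (j k) (T + 1)) {..L} k) \<omega> +
      freeze T (N k) (restrict (\<lambda>k. min (j k) (T + 1)) {..L} (k - 1)) \<omega> -
      freeze T (N k) (restrict (\<lambda>k. min (j k) (T + 1)) {..L} k) \<omega>"
    unfolding restrict_apply'[OF \<open>k \<in> {..L}\<close>] restrict_apply'[OF \<open>k - 1 \<in> {..L}\<close>]
    by (simp add: payoff_def freeze_def)
qed

lemma finite_path_values: "finite ((\<lambda>j. path_value T L H N j \<omega>) ` exercise_dates L t)"
proof (rule finite_subset)
  show "(\<lambda>j. path_value T L H N j \<omega>) ` exercise_dates L t
      \<subseteq> (\<lambda>j. path_value T L H N j \<omega>) ` ({..L} \<rightarrow>\<^sub>E {..T + 1})"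
  proof (rule image_subsetI)
    fix j :: "nat \<Rightarrow> nat"
    have "restrict (\<lambda>k. min (j k) (T + 1)) {..L} \<in> {..L} \<rightarrow>\<^sub>E {..T + 1}"
      by (simp add: PiE_iff)
    then show "path_value T L H N j \<omega>
        \<in> (\<lambda>j. path_value T L H N j \<omega>) ` ({..L} \<rightarrow>\<^sub>E {..T + 1})"
      by (subst path_value_truncate) (rule imageI)
  qed
  show "finite ((\<lambda>j. path_value T L H N j \<omega>) ` ({..L} \<rightarrow>\<^sub>E {..T + 1}))"
    by (intro finite_imageI finite_PiE) auto
qed

lemma exercise_dates_nonempty: "exercise_dates L t \<noteq> {}"
proof -
  have "(\<lambda>k. t + k) \<in> exercise_dates L t" by (simp add: exercise_dates_def)
  then show ?thesis by blast
qed

end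

theory Submission
  imports Defs
begin

text \<open>
  The envelopes are computed by backward induction. With \<open>q\<close> rights left at time \<open>r\<close>, either one
  right is used, which yields \<open>H r\<close> and leaves \<open>q - 1\<close> rights from \<open>r + 1\<close> on, or nothing happens
  and \<open>q\<close> rights are left from \<open>r + 1\<close> on. Locality splits any strategy along the event of immediate
  exercise, time consistency and translation invariance evaluate both parts (\<open>bellman_upper\<close>), and
  pasting optimal continuations along the event where immediate exercise is the better choice
  attains the bound (\<open>bellman_attained\<close>). Hence the essential supremum is an attained, finite maximum
  that satisfies the Bellman principle (\<open>optimal_value_snell\<close>, \<open>snell_bellman\<close>).

  For the dual side, two opposite inequalities are compared.

  \<^item> Under subadditivity a martingale stopped at two ordered stopping times has an increment of
    nonpositive value: the increment is a sum of one-step increments, each multiplied by the indicator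
    of an event known at its beginning, and each of these has value zero (\<open>optional_sampling\<close>).
    Adding such increments to the reward of an optimal exercise vector, whose dates are among the
    competitors in the pathwise maximum, shows that every choice of martingales gives an upper bound
    (\<open>weak_duality\<close>).

  \<^item> For the martingales whose increments are those of the envelopes, the Bellman principle can be
    followed path by path along any vector of dates. The increments of the martingales cancel those
    of the envelopes, and the pathwise maximum is at most the envelope at the initial time, almost
    surely and before any valuation is applied (\<open>multiple_stopping_pathwise_bound\<close>,
    \<open>pathwise_max_le_snell\<close>).

  Valuing the second bound and combining it with the first gives equality, so the infimum is attained.
  The pathwise maximum then lies below the envelope and has the same value; since the envelope is known
  at the initial time, sensitivity makes the two random variables equal.
\<close>

section \<open>Conditional valuations extended beyond the horizon\<close>

locale conditional_valuation = dynamic_setting +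
  assumes C1: "monotone_functional P T \<XX> \<rho>"
    and C2: "local_functional P F T \<XX> \<rho>"
    and C3: "time_consistent_functional P T \<XX> \<rho>"
    and C4: "translation_invariant_functional P F T \<XX> \<rho>"
begin

text \<open>The valuation is continued beyond the horizon in the same way as the filtration. From \<open>T\<close> on it is
  then the identity, and no statement about time steps has to treat the last step separately.\<close>

abbreviation \<FF> :: "nat \<Rightarrow> 'a measure" where "\<FF> \<equiv> freeze T F"
abbreviation \<phi> :: "nat \<Rightarrow> ('a \<Rightarrow> real) \<Rightarrow> 'a \<Rightarrow> real" where "\<phi> \<equiv> freeze T \<rho>"

definition known :: "nat \<Rightarrow> ('a \<Rightarrow> real) set" where
  "known s = \<XX> \<inter> L0 P (\<FF> s)"

sublocale filt: filtration "space P" \<FF>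
  by (rule filtration)

lemma sets_FF_subset: "sets (\<FF> s) \<subseteq> sets P"
  using filt.sets_F_mono[of "min s T" T] sets_F_T by (simp add: freeze_def)

lemma measurable_FF_mono: "s \<le> u \<Longrightarrow> X \<in> borel_measurable (\<FF> s) \<Longrightarrow> X \<in> borel_measurable (\<FF> u)"
  using filt.sets_F_mono[of s u] filt.space_F[of s] filt.space_F[of u]
  by (auto simp: measurable_def)

lemma sets_FF_horizon: "T \<le> s \<Longrightarrow> sets (\<FF> s) = sets P"
  using sets_F_T by (simp add: freeze_def)

lemma XX_measurable: "X \<in> \<XX> \<Longrightarrow> X \<in> borel_measurable P"
  using X_measurable by blast

lemma XX_zero: "(\<lambda>_. 0) \<in> \<XX>"
  using X_scale[of "indicator {}" 0] X_indicator[of "{}"] by simp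

lemma XX_diff: "X \<in> \<XX> \<Longrightarrow> Y \<in> \<XX> \<Longrightarrow> (\<lambda>\<omega>. X \<omega> - Y \<omega>) \<in> \<XX>"
  using X_add[of X "\<lambda>\<omega>. - 1 * Y \<omega>"] X_scale[of Y "- 1"] by simp

lemma XX_sum: "(\<And>i. i \<in> I \<Longrightarrow> X i \<in> \<XX>) \<Longrightarrow> (\<lambda>\<omega>. \<Sum>i\<in>I. X i \<omega>) \<in> \<XX>"
  by (induction I rule: infinite_finite_induct) (simp_all add: XX_zero X_add)

lemma XX_Max:
  assumes "finite I" "I \<noteq> {}" "\<And>i. i \<in> I \<Longrightarrow> X i \<in> \<XX>"
  shows "(\<lambda>\<omega>. Max ((\<lambda>i. X i \<omega>) ` I)) \<in> \<XX>"
  using assms by (induction I rule: finite_ne_induct) (simp_all add: X_max)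

lemma XX_indicator_mult: "A \<in> sets P \<Longrightarrow> X \<in> \<XX> \<Longrightarrow> (\<lambda>\<omega>. indicator A \<omega> * X \<omega>) \<in> \<XX>"
  using C2 sets_F_T unfolding local_functional_def by blast

lemma knownI:
  "X \<in> \<XX> \<Longrightarrow> X' \<in> borel_measurable (\<FF> s) \<Longrightarrow> AE \<omega> in P. X \<omega> = X' \<omega> \<Longrightarrow> X \<in> known s"
  unfolding known_def L0_def using XX_measurable by blast

lemma knownE:
  assumes "X \<in> known s"
  obtains X' where "X' \<in> borel_measurable (\<FF> s)" "AE \<omega> in P. X \<omega> = X' \<omega>"
  using assms unfolding known_def L0_def by blast

lemma known_XX: "X \<in> known s \<Longrightarrow> X \<in> \<XX>"
  by (simp add: known_def)

lemma known_mono: "s \<le> u \<Longrightarrow> X \<in> known s \<Longrightarrow> X \<in> known u"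
  by (meson knownE knownI known_XX measurable_FF_mono)

lemma known_cong:
  assumes "X \<in> known s" "Y \<in> borel_measurable P" "AE \<omega> in P. X \<omega> = Y \<omega>"
  shows "Y \<in> known s"
proof -
  obtain X' where X': "X' \<in> borel_measurable (\<FF> s)" "AE \<omega> in P. X \<omega> = X' \<omega>"
    using assms(1) by (rule knownE)
  show ?thesis
  proof (rule knownI[OF _ X'(1)])
    show "Y \<in> \<XX>" using assms known_XX X_AE_closed by blast
    show "AE \<omega> in P. Y \<omega> = X' \<omega>" using X'(2) assms(3) by eventually_elim simp
  qed
qed

lemma known_zero: "(\<lambda>_. 0) \<in> known s"
  by (rule knownI[OF XX_zero, where X' = "\<lambda>_. 0"]) auto

lemma known_add:
  assumes "X \<in> known s" "Y \<in> known s" shows "(\<lambda>\<omega>. X \<omega> + Y \<omega>) \<in> known s"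
proof -
  obtain X' Y' where *: "X' \<in> borel_measurable (\<FF> s)" "AE \<omega> in P. X \<omega> = X' \<omega>"
    "Y' \<in> borel_measurable (\<FF> s)" "AE \<omega> in P. Y \<omega> = Y' \<omega>"
    using knownE[OF assms(1)] knownE[OF assms(2)] by metis
  show ?thesis
  proof (rule knownI)
    show "(\<lambda>\<omega>. X' \<omega> + Y' \<omega>) \<in> borel_measurable (\<FF> s)" using *(1,3) by measurable
    show "AE \<omega> in P. X \<omega> + Y \<omega> = X' \<omega> + Y' \<omega>" using *(2,4) by eventually_elim simp
  qed (use assms known_XX X_add in blast)
qed

lemma known_max:
  assumes "X \<in> known s" "Y \<in> known s" shows "(\<lambda>\<omega>. max (X \<omega>) (Y \<omega>)) \<in> known s"
proof -
  obtain X' Y' where *: "X' \<in> borel_measurable (\<FF> s)" "AE \<omega> in P. X \<omega> = X' \<omega>"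
    "Y' \<in> borel_measurable (\<FF> s)" "AE \<omega> in P. Y \<omega> = Y' \<omega>"
    using knownE[OF assms(1)] knownE[OF assms(2)] by metis
  show ?thesis
  proof (rule knownI)
    show "(\<lambda>\<omega>. max (X' \<omega>) (Y' \<omega>)) \<in> borel_measurable (\<FF> s)" using *(1,3) by measurable
    show "AE \<omega> in P. max (X \<omega>) (Y \<omega>) = max (X' \<omega>) (Y' \<omega>)" using *(2,4) by eventually_elim simp
  qed (use assms known_XX X_max in blast)
qed

lemma known_scale:
  assumes "X \<in> known s" shows "(\<lambda>\<omega>. c * X \<omega>) \<in> known s"
proof -
  obtain X' where *: "X' \<in> borel_measurable (\<FF> s)" "AE \<omega> in P. X \<omega> = X' \<omega>"
    using assms by (rule knownE)
  show ?thesis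
  proof (rule knownI)
    show "(\<lambda>\<omega>. c * X' \<omega>) \<in> borel_measurable (\<FF> s)" using *(1) by measurable
    show "AE \<omega> in P. c * X \<omega> = c * X' \<omega>" using *(2) by eventually_elim simp
  qed (use assms known_XX X_scale in blast)
qed

lemma known_diff: "X \<in> known s \<Longrightarrow> Y \<in> known s \<Longrightarrow> (\<lambda>\<omega>. X \<omega> - Y \<omega>) \<in> known s"
  using known_add[of X s "\<lambda>\<omega>. - 1 * Y \<omega>"] known_scale[of Y s "- 1"] by simp

lemma phi_known: "X \<in> \<XX> \<Longrightarrow> \<phi> s X \<in> known s"
  using rho_range[of "min s T" X] by (simp add: known_def freeze_def)

lemma phi_XX: "X \<in> \<XX> \<Longrightarrow> \<phi> s X \<in> \<XX>"
  by (rule known_XX[OF phi_known])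

lemma phi_cong: "X \<in> \<XX> \<Longrightarrow> Y \<in> \<XX> \<Longrightarrow> AE \<omega> in P. X \<omega> = Y \<omega> \<Longrightarrow> AE \<omega> in P. \<phi> s X \<omega> = \<phi> s Y \<omega>"
  using rho_AE_cong[of "min s T" X Y] by (simp add: freeze_def)

lemma phi_mono: "X \<in> \<XX> \<Longrightarrow> Y \<in> \<XX> \<Longrightarrow> AE \<omega> in P. X \<omega> \<le> Y \<omega> \<Longrightarrow> AE \<omega> in P. \<phi> s X \<omega> \<le> \<phi> s Y \<omega>"
  using C1 unfolding monotone_functional_def freeze_def by simp

lemma phi_indicator_mult:
  "X \<in> \<XX> \<Longrightarrow> A \<in> sets (\<FF> s) \<Longrightarrow>
    AE \<omega> in P. \<phi> s (\<lambda>\<omega>. indicator A \<omega> * X \<omega>) \<omega> = indicator A \<omega> * \<phi> s X \<omega>"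
  using C2 unfolding local_functional_def freeze_def by simp

lemma phi_translate:
  "X \<in> \<XX> \<Longrightarrow> Y \<in> known s \<Longrightarrow> AE \<omega> in P. \<phi> s (\<lambda>\<omega>. X \<omega> + Y \<omega>) \<omega> = \<phi> s X \<omega> + Y \<omega>"
  using C4 unfolding translation_invariant_functional_def freeze_def known_def by simp

lemma phi_zero: "AE \<omega> in P. \<phi> s (\<lambda>_. 0) \<omega> = 0"
  using phi_indicator_mult[OF XX_zero, of "{}" s] by simp

text \<open>A claim that is already known is a translation of the zero claim, whose value is zero by locality on
  the empty event.\<close>

lemma phi_of_known: "Y \<in> known s \<Longrightarrow> AE \<omega> in P. \<phi> s Y \<omega> = Y \<omega>"
  using phi_translate[OF XX_zero, of Y s] phi_zero[of s] by (auto elim: eventually_elim2)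

lemma known_horizon: "T \<le> s \<Longrightarrow> X \<in> \<XX> \<Longrightarrow> X \<in> known s"
  by (rule knownI[of X X]) (auto simp: XX_measurable measurable_cong_sets[OF sets_FF_horizon refl])

lemma phi_tower_Suc:
  assumes X: "X \<in> \<XX>"
  shows "AE \<omega> in P. \<phi> s X \<omega> = \<phi> s (\<phi> (Suc s) X) \<omega>"
proof (cases "s < T")
  case True
  then have "min s T = s" "min (Suc s) T = Suc s" by auto
  then show ?thesis using C3 X True unfolding time_consistent_functional_def freeze_def by simp
next
  case False
  \<comment> \<open>everything is known from the horizon on, so the inner valuation changes nothing\<close>
  have "AE \<omega> in P. \<phi> (Suc s) X \<omega> = X \<omega>"
    by (rule phi_of_known[OF known_horizon]) (use False X in auto)
  then have "AE \<omega> in P. X \<omega> = \<phi> (Suc s) X \<omega>" by eventually_elim simp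
  then show ?thesis by (intro phi_cong phi_XX X)
qed


lemma phi_tower:
  assumes "s \<le> u" and X: "X \<in> \<XX>"
  shows "AE \<omega> in P. \<phi> s X \<omega> = \<phi> s (\<phi> u X) \<omega>"
  using \<open>s \<le> u\<close>
proof (induction s rule: inc_induct)
  case base
  have "AE \<omega> in P. \<phi> u (\<phi> u X) \<omega> = \<phi> u X \<omega>" by (rule phi_of_known[OF phi_known[OF X]])
  then show ?case by eventually_elim simp
next
  case (step s)
  have "AE \<omega> in P. \<phi> s (\<phi> (Suc s) X) \<omega> = \<phi> s (\<phi> (Suc s) (\<phi> u X)) \<omega>"
    by (intro phi_cong phi_XX X step.IH)
  with phi_tower_Suc[OF X, of s] phi_tower_Suc[OF phi_XX[OF X], of s u] show ?case
    by eventually_elim simp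
qed

text \<open>Multiplied by the indicator of the event, the two claims coincide, and locality takes the
  indicator out of the valuation. This is how strategies are modified on part of the space.\<close>

lemma phi_local:
  assumes X: "X \<in> \<XX>" and Y: "Y \<in> \<XX>" and A: "A \<in> sets (\<FF> s)"
    and eq: "AE \<omega> in P. \<omega> \<in> A \<longrightarrow> X \<omega> = Y \<omega>"
  shows "AE \<omega> in P. \<omega> \<in> A \<longrightarrow> \<phi> s X \<omega> = \<phi> s Y \<omega>"
proof -
  have AP: "A \<in> sets P" using A sets_FF_subset by blast
  have "AE \<omega> in P. indicator A \<omega> * X \<omega> = indicator A \<omega> * Y \<omega>"
    using eq by eventually_elim (simp add: indicator_def)
  then have "AE \<omega> in P. \<phi> s (\<lambda>\<omega>. indicator A \<omega> * X \<omega>) \<omega> = \<phi> s (\<lambda>\<omega>. indicator A \<omega> * Y \<omega>) \<omega>"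
    by (intro phi_cong XX_indicator_mult AP X Y)
  with phi_indicator_mult[OF X A] phi_indicator_mult[OF Y A] show ?thesis
    by eventually_elim (auto simp: indicator_def)
qed

end

section \<open>Rewards of stopping times\<close>

context conditional_valuation
begin

lemma stopping_le: "stopping_time \<FF> \<sigma> \<Longrightarrow> {\<omega> \<in> space P. \<sigma> \<omega> \<le> s} \<in> sets (\<FF> s)"
  using stopping_timeD[of \<FF> \<sigma> s] by (simp add: pred_def filt.space_F)

lemma stopping_gt: "stopping_time \<FF> \<sigma> \<Longrightarrow> {\<omega> \<in> space P. s < \<sigma> \<omega>} \<in> sets (\<FF> s)"
  using stopping_timeD2[of \<FF> \<sigma> s] by (simp add: pred_def filt.space_F)

lemma stopping_measurable:
  fixes \<sigma> :: "'a \<Rightarrow> nat"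
  assumes "stopping_time \<FF> \<sigma>"
  shows "\<sigma> \<in> measurable P (count_space UNIV)"
proof -
  have "\<sigma> \<in> borel_measurable P"
    by (rule measurable_stopping_time[OF assms]) (simp_all add: sets_FF_subset filt.space_F)
  then show ?thesis by (simp add: measurable_cong_sets[OF refl sets_borel_eq_count_space])
qed

text \<open>The domain of the valuation is only assumed to be closed under finite operations. Since \<open>G\<close> is constant from
  \<open>N\<close> on, the stopped claim is a finite sum of claims cut off by indicators.\<close>

lemma stopped_XX:
  fixes \<sigma> :: "'a \<Rightarrow> nat"
  assumes \<sigma>: "stopping_time \<FF> \<sigma>" and G: "\<And>j. G j \<in> \<XX>"
    and late: "\<And>j. G j = G (min j N)"
  shows "(\<lambda>\<omega>. G (\<sigma> \<omega>) \<omega>) \<in> \<XX>"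
proof (rule X_AE_closed)
  note stopping_measurable[OF \<sigma>, measurable]
  define B where "B j = {\<omega> \<in> space P. min (\<sigma> \<omega>) N = j}" for j
  have B: "B j \<in> sets P" for j unfolding B_def by measurable
  show "(\<lambda>\<omega>. \<Sum>j\<le>N. indicator (B j) \<omega> * G j \<omega>) \<in> \<XX>"
    by (intro XX_sum XX_indicator_mult B G)
  show "(\<lambda>\<omega>. G (\<sigma> \<omega>) \<omega>) \<in> borel_measurable P"
    by (rule measurable_compose_countable[OF XX_measurable[OF G] stopping_measurable[OF \<sigma>]])
  show "AE \<omega> in P. (\<Sum>j\<le>N. indicator (B j) \<omega> * G j \<omega>) = G (\<sigma> \<omega>) \<omega>"
  proof (rule AE_I2)
    fix \<omega> assume "\<omega> \<in> space P"
    then have "(\<Sum>j\<le>N. indicator (B j) \<omega> * G j \<omega>)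
        = (\<Sum>j\<le>N. if min (\<sigma> \<omega>) N = j then G j \<omega> else 0)"
      by (intro sum.cong) (auto simp: B_def indicator_def)
    also have "\<dots> = G (min (\<sigma> \<omega>) N) \<omega>" by simp
    finally show "(\<Sum>j\<le>N. indicator (B j) \<omega> * G j \<omega>) = G (\<sigma> \<omega>) \<omega>"
      using late[of "\<sigma> \<omega>"] by simp
  qed
qed

text \<open>The lower bounds have to hold everywhere, not just almost surely: the sigma-algebras need not contain
  the null sets, and at times before \<open>r\<close> the event \<open>A\<close> is not available, so that the choice must
  not have stopped there at all.\<close>

lemma stopping_time_if:
  fixes \<sigma> \<sigma>' :: "'a \<Rightarrow> nat"
  assumes A: "A \<in> sets (\<FF> r)"
    and \<sigma>: "stopping_time \<FF> \<sigma>" "\<And>\<omega>. r \<le> \<sigma> \<omega>"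
    and \<sigma>': "stopping_time \<FF> \<sigma>'" "\<And>\<omega>. r \<le> \<sigma>' \<omega>"
  shows "stopping_time \<FF> (\<lambda>\<omega>. if \<omega> \<in> A then \<sigma> \<omega> else \<sigma>' \<omega>)"
proof
  fix s
  show "Measurable.pred (\<FF> s) (\<lambda>\<omega>. (if \<omega> \<in> A then \<sigma> \<omega> else \<sigma>' \<omega>) \<le> s)"
  proof (cases "r \<le> s")
    case True
    have [measurable]: "A \<in> sets (\<FF> s)" using A filt.sets_F_mono[OF True] by blast
    note [measurable] = stopping_timeD[OF \<sigma>(1), of s] stopping_timeD[OF \<sigma>'(1), of s]
    have "(\<lambda>\<omega>. (if \<omega> \<in> A then \<sigma> \<omega> else \<sigma>' \<omega>) \<le> s)
        = (\<lambda>\<omega>. (\<omega> \<in> A \<and> \<sigma> \<omega> \<le> s) \<or> (\<omega> \<notin> A \<and> \<sigma>' \<omega> \<le> s))" by auto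
    then show ?thesis by simp
  next
    case False
    then have "(\<lambda>\<omega>. (if \<omega> \<in> A then \<sigma> \<omega> else \<sigma>' \<omega>) \<le> s) = (\<lambda>_. False)"
      using le_trans[OF \<sigma>(2)] le_trans[OF \<sigma>'(2)] by auto
    then show ?thesis by simp
  qed
qed

lemma exercise_times_chain:
  assumes "\<tau> \<in> exercise_times P F T q r"
  shows "AE \<omega> in P. r \<le> \<tau> 1 \<omega> \<and> (\<forall>l\<in>{1..q}. \<tau> 1 \<omega> + l \<le> \<tau> l \<omega> + 1)"
proof -
  have "AE \<omega> in P. \<forall>l\<in>{2..q}. \<tau> (l - 1) \<omega> + 1 \<le> \<tau> l \<omega>"
    using assms by (intro AE_finite_allI) (auto simp: exercise_times_def)
  moreover have "AE \<omega> in P. r \<le> \<tau> 1 \<omega>" using assms by (simp add: exercise_times_def)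
  ultimately show ?thesis
  proof eventually_elim
    case (elim \<omega>)
    have "\<tau> 1 \<omega> + l \<le> \<tau> l \<omega> + 1" if "1 \<le> l" "l \<le> q" for l
      using that
    proof (induction l rule: dec_induct)
      case (step l)
      then have "\<tau> l \<omega> + 1 \<le> \<tau> (Suc l) \<omega>" using elim(1) by (auto dest: bspec[of _ _ "Suc l"])
      then show ?case using step by simp
    qed simp
    then show ?case using elim(2) by simp
  qed
qed

text \<open>Raising the components makes a vector admissible from \<open>r + 1\<close> on over the whole space. By
  \<open>exercise_times_chain\<close> it changes nothing where the first date is later than \<open>r\<close>; so a strategy
  known to be later than \<open>r\<close> on an event is turned into an admissible one that agrees with it there.\<close>

lemma raised_exercise_times:
  assumes "\<And>l. l \<in> {1..q} \<Longrightarrow> stopping_time \<FF> (\<tau> l)"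
    and "\<And>l. 1 < l \<Longrightarrow> l \<le> q \<Longrightarrow> AE \<omega> in P. \<tau> (l - 1) \<omega> + 1 \<le> \<tau> l \<omega>"
  shows "(\<lambda>l \<omega>. max (\<tau> l \<omega>) (r + l)) \<in> exercise_times P F T q (Suc r)"
  unfolding exercise_times_def
proof (intro CollectI conjI ballI allI impI)
  show "stopping_time \<FF> (\<lambda>\<omega>. max (\<tau> l \<omega>) (r + l))" if "l \<in> {1..q}" for l
    by (intro stopping_time_max stopping_time_const assms(1) that)
  show "AE \<omega> in P. max (\<tau> (l - 1) \<omega>) (r + (l - 1)) + 1 \<le> max (\<tau> l \<omega>) (r + l)"
    if "1 < l \<and> l \<le> q" for l
    using assms(2)[of l] that by (auto elim!: eventually_mono)
qed auto

end

locale adapted_reward = conditional_valuation +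
  fixes H
  assumes H: "H \<in> adapted_processes P F T \<XX>"
begin

definition reward :: "nat \<Rightarrow> (nat \<Rightarrow> 'a \<Rightarrow> nat) \<Rightarrow> 'a \<Rightarrow> real" where
  "reward q \<tau> \<omega> = (\<Sum>l=1..q. payoff T H (\<tau> l \<omega>) \<omega>)"

lemma payoff_known: "payoff T H s \<in> known s"
proof (cases "s \<le> T")
  case True
  then have "payoff T H s = H s" by (simp add: payoff_def fun_eq_iff)
  moreover have "min s T = s" using True by simp
  ultimately show ?thesis using H True by (simp add: adapted_processes_def known_def freeze_def)
next
  case False
  then have "payoff T H s = (\<lambda>_. 0)" by (simp add: payoff_def fun_eq_iff)
  then show ?thesis by (simp add: known_zero)
qed

lemma payoff_stopped_XX:
  fixes \<sigma> :: "'a \<Rightarrow> nat"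
  assumes "stopping_time \<FF> \<sigma>"
  shows "(\<lambda>\<omega>. payoff T H (\<sigma> \<omega>) \<omega>) \<in> \<XX>"
  by (rule stopped_XX[OF assms known_XX[OF payoff_known], where N = "Suc T"])
     (auto simp: payoff_def fun_eq_iff)

lemma reward_XX: "\<tau> \<in> exercise_times P F T q r \<Longrightarrow> reward q \<tau> \<in> \<XX>"
  unfolding reward_def[abs_def]
  by (intro XX_sum payoff_stopped_XX) (auto simp: exercise_times_def)

lemma reward_Suc: "reward (Suc p) \<tau> \<omega> = payoff T H (\<tau> 1 \<omega>) \<omega> + reward p (\<lambda>l. \<tau> (Suc l)) \<omega>"
  unfolding reward_def
  by (subst sum.atLeast_Suc_atMost) (simp_all del: sum.cl_ivl_Suc add: sum.atLeast_Suc_atMost_Suc_shift)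

lemma reward_cong: "(\<And>l. l \<in> {1..q} \<Longrightarrow> \<tau> l \<omega> = \<sigma> l \<omega>) \<Longrightarrow> reward q \<tau> \<omega> = reward q \<sigma> \<omega>"
  unfolding reward_def by (intro sum.cong) auto

section \<open>Dynamic programming\<close>

text \<open>Attainment is what makes the backward induction work: the valuation has no continuity property by
  which the value of a supremum could be approximated by the values of strategies. The optimal
  dates are required to be at least \<open>r\<close> at every point, so that they can be pasted by
  \<open>stopping_time_if\<close>.\<close>

definition optimal_value :: "nat \<Rightarrow> nat \<Rightarrow> ('a \<Rightarrow> real) \<Rightarrow> bool" where
  "optimal_value q r Z \<longleftrightarrow> Z \<in> known r \<and>
     (\<forall>\<tau>\<in>exercise_times P F T q r. AE \<omega> in P. \<phi> r (reward q \<tau>) \<omega> \<le> Z \<omega>) \<and>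
     (\<exists>\<tau>\<in>exercise_times P F T q r. (\<forall>l \<omega>. r \<le> \<tau> l \<omega>) \<and> (AE \<omega> in P. \<phi> r (reward q \<tau>) \<omega> = Z \<omega>))"

lemma optimal_value_cong:
  assumes Z: "optimal_value q r Z" and "Z' \<in> borel_measurable P" and eq: "AE \<omega> in P. Z \<omega> = Z' \<omega>"
  shows "optimal_value q r Z'"
  unfolding optimal_value_def
proof (intro conjI ballI)
  show "Z' \<in> known r" using assms known_cong unfolding optimal_value_def by blast
  show "AE \<omega> in P. \<phi> r (reward q \<tau>) \<omega> \<le> Z' \<omega>" if "\<tau> \<in> exercise_times P F T q r" for \<tau>
  proof -
    have "AE \<omega> in P. \<phi> r (reward q \<tau>) \<omega> \<le> Z \<omega>" using Z that unfolding optimal_value_def by blast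
    with eq show ?thesis by eventually_elim simp
  qed
  obtain \<tau> where \<tau>: "\<tau> \<in> exercise_times P F T q r" "\<forall>l \<omega>. r \<le> \<tau> l \<omega>"
    "AE \<omega> in P. \<phi> r (reward q \<tau>) \<omega> = Z \<omega>" using Z unfolding optimal_value_def by blast
  have "AE \<omega> in P. \<phi> r (reward q \<tau>) \<omega> = Z' \<omega>" using \<tau>(3) eq by eventually_elim simp
  with \<tau> show "\<exists>\<tau>\<in>exercise_times P F T q r.
      (\<forall>l \<omega>. r \<le> \<tau> l \<omega>) \<and> (AE \<omega> in P. \<phi> r (reward q \<tau>) \<omega> = Z' \<omega>)" by blast
qed

lemma optimal_value_worthless:
  assumes "q = 0 \<or> T < r"
  shows "optimal_value q r (\<lambda>_. 0)"
proof -
  have *: "AE \<omega> in P. \<phi> r (reward q \<tau>) \<omega> = 0" if \<tau>: "\<tau> \<in> exercise_times P F T q r" for \<tau>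
  proof -
    have "AE \<omega> in P. reward q \<tau> \<omega> = 0"
      using exercise_times_chain[OF \<tau>]
    proof eventually_elim
      case (elim \<omega>)
      show ?case unfolding reward_def
      proof (rule sum.neutral, rule ballI)
        fix l assume l: "l \<in> {1..q}"
        have "\<tau> 1 \<omega> + l \<le> \<tau> l \<omega> + 1" using elim l by blast
        moreover have "1 \<le> l" "T < r" using l assms by auto
        moreover have "r \<le> \<tau> 1 \<omega>" using elim by blast
        ultimately have "T < \<tau> l \<omega>" by linarith
        then show "payoff T H (\<tau> l \<omega>) \<omega> = 0" by (simp add: payoff_def)
      qed
    qed
    then have "AE \<omega> in P. \<phi> r (reward q \<tau>) \<omega> = \<phi> r (\<lambda>_. 0) \<omega>"
      by (intro phi_cong reward_XX[OF \<tau>] XX_zero)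
    with phi_zero[of r] show ?thesis by eventually_elim simp
  qed
  have \<tau>: "(\<lambda>l _. r + l) \<in> exercise_times P F T q r"
    by (auto simp: exercise_times_def stopping_time_const)
  show ?thesis
    unfolding optimal_value_def
  proof (intro conjI ballI known_zero bexI[OF _ \<tau>])
    show "AE \<omega> in P. \<phi> r (reward q \<tau>) \<omega> \<le> 0" if "\<tau> \<in> exercise_times P F T q r" for \<tau>
      using *[OF that] by eventually_elim simp
  qed (auto intro: *[OF \<tau>])
qed

lemma phi_reward_now:
  assumes "\<sigma> \<in> exercise_times P F T p (Suc r)"
  shows "AE \<omega> in P. \<phi> r (\<lambda>\<omega>. reward p \<sigma> \<omega> + payoff T H r \<omega>) \<omega>
    = payoff T H r \<omega> + \<phi> r (\<phi> (Suc r) (reward p \<sigma>)) \<omega>"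
  using phi_translate[OF reward_XX[OF assms] payoff_known[of r]] phi_tower_Suc[OF reward_XX[OF assms], of r]
  by eventually_elim simp

text \<open>On the event that the first right is exercised at \<open>r\<close>, the remaining dates form a vector with one
  right less that is admissible from \<open>r + 1\<close> on; on the complement the whole vector is admissible from
  \<open>r + 1\<close> on. Both become admissible on the whole space after raising, and locality reduces the value
  of the reward to the values of the two continuations.\<close>

lemma bellman_upper:
  assumes Z0: "optimal_value p (Suc r) Z0" and Z1: "optimal_value (Suc p) (Suc r) Z1"
    and \<tau>: "\<tau> \<in> exercise_times P F T (Suc p) r"
  shows "AE \<omega> in P. \<phi> r (reward (Suc p) \<tau>) \<omega> \<le> max (payoff T H r \<omega> + \<phi> r Z0 \<omega>) (\<phi> r Z1 \<omega>)"
proof -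
  define \<sigma>0 where "\<sigma>0 = (\<lambda>l \<omega>. max (\<tau> (Suc l) \<omega>) (r + l))"
  define \<sigma>1 where "\<sigma>1 = (\<lambda>l \<omega>. max (\<tau> l \<omega>) (r + l))"
  define A where "A = {\<omega> \<in> space P. \<tau> 1 \<omega> \<le> r}"
  define B where "B = {\<omega> \<in> space P. r < \<tau> 1 \<omega>}"
  have st: "stopping_time \<FF> (\<tau> l)" if "l \<in> {1..Suc p}" for l
    using \<tau> that by (simp add: exercise_times_def)
  have ord: "AE \<omega> in P. \<tau> (l - 1) \<omega> + 1 \<le> \<tau> l \<omega>" if "1 < l" "l \<le> Suc p" for l
    using \<tau> that unfolding exercise_times_def by blast
  have \<sigma>0: "\<sigma>0 \<in> exercise_times P F T p (Suc r)" unfolding \<sigma>0_def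
  proof (rule raised_exercise_times)
    show "AE \<omega> in P. \<tau> (Suc (l - 1)) \<omega> + 1 \<le> \<tau> (Suc l) \<omega>" if "1 < l" "l \<le> p" for l
      using ord[of "Suc l"] that by simp
  qed (simp add: st)
  have \<sigma>1: "\<sigma>1 \<in> exercise_times P F T (Suc p) (Suc r)" unfolding \<sigma>1_def
    by (rule raised_exercise_times) (use st ord in auto)
  have A: "A \<in> sets (\<FF> r)" and B: "B \<in> sets (\<FF> r)"
    unfolding A_def B_def by (intro stopping_le stopping_gt st; simp)+
  note chain = exercise_times_chain[OF \<tau>]

  have "AE \<omega> in P. \<omega> \<in> A \<longrightarrow> reward (Suc p) \<tau> \<omega> = reward p \<sigma>0 \<omega> + payoff T H r \<omega>"
    using chain
  proof eventually_elim
    case (elim \<omega>)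
    have "reward p (\<lambda>l. \<tau> (Suc l)) \<omega> = reward p \<sigma>0 \<omega>"
    proof (rule reward_cong)
      fix l assume "l \<in> {1..p}"
      then have "\<tau> 1 \<omega> + Suc l \<le> \<tau> (Suc l) \<omega> + 1" by (intro bspec[OF conjunct2[OF elim]]) auto
      then show "\<tau> (Suc l) \<omega> = \<sigma>0 l \<omega>" using elim by (simp add: \<sigma>0_def)
    qed
    then show ?case using elim by (auto simp: A_def reward_Suc)
  qed
  then have onA: "AE \<omega> in P. \<omega> \<in> A \<longrightarrow>
      \<phi> r (reward (Suc p) \<tau>) \<omega> = \<phi> r (\<lambda>\<omega>. reward p \<sigma>0 \<omega> + payoff T H r \<omega>) \<omega>"
    by (intro phi_local reward_XX[OF \<tau>] X_add reward_XX[OF \<sigma>0] known_XX[OF payoff_known] A)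
  have "AE \<omega> in P. \<phi> r (\<phi> (Suc r) (reward p \<sigma>0)) \<omega> \<le> \<phi> r Z0 \<omega>"
    using Z0 \<sigma>0 unfolding optimal_value_def by (intro phi_mono phi_XX reward_XX[OF \<sigma>0]) (auto dest: known_XX)
  with onA phi_reward_now[OF \<sigma>0]
  have boundA: "AE \<omega> in P. \<omega> \<in> A \<longrightarrow> \<phi> r (reward (Suc p) \<tau>) \<omega> \<le> payoff T H r \<omega> + \<phi> r Z0 \<omega>"
    by eventually_elim simp

  have "AE \<omega> in P. \<omega> \<in> B \<longrightarrow> reward (Suc p) \<tau> \<omega> = reward (Suc p) \<sigma>1 \<omega>"
    using chain
  proof eventually_elim
    case (elim \<omega>)
    have "reward (Suc p) \<tau> \<omega> = reward (Suc p) \<sigma>1 \<omega>" if "\<omega> \<in> B"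
    proof (rule reward_cong)
      fix l assume "l \<in> {1..Suc p}"
      then have "\<tau> 1 \<omega> + l \<le> \<tau> l \<omega> + 1" using elim by blast
      then show "\<tau> l \<omega> = \<sigma>1 l \<omega>" using that by (simp add: \<sigma>1_def B_def)
    qed
    then show ?case by blast
  qed
  then have onB: "AE \<omega> in P. \<omega> \<in> B \<longrightarrow> \<phi> r (reward (Suc p) \<tau>) \<omega> = \<phi> r (reward (Suc p) \<sigma>1) \<omega>"
    by (intro phi_local reward_XX[OF \<tau>] reward_XX[OF \<sigma>1] B)
  have "AE \<omega> in P. \<phi> r (\<phi> (Suc r) (reward (Suc p) \<sigma>1)) \<omega> \<le> \<phi> r Z1 \<omega>"
    using Z1 \<sigma>1 unfolding optimal_value_def by (intro phi_mono phi_XX reward_XX[OF \<sigma>1]) (auto dest: known_XX)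
  with onB phi_tower_Suc[OF reward_XX[OF \<sigma>1], of r]
  have boundB: "AE \<omega> in P. \<omega> \<in> B \<longrightarrow> \<phi> r (reward (Suc p) \<tau>) \<omega> \<le> \<phi> r Z1 \<omega>"
    by eventually_elim simp
  show ?thesis using boundA boundB AE_space
    by eventually_elim (auto simp: A_def B_def le_max_iff_disj)
qed

text \<open>Optimal continuations are pasted along the event where immediate exercise is at least as good as
  waiting.\<close>

lemma bellman_attained:
  assumes Z0: "optimal_value p (Suc r) Z0" and Z1: "optimal_value (Suc p) (Suc r) Z1"
  shows "\<exists>\<tau>\<in>exercise_times P F T (Suc p) r. (\<forall>l \<omega>. r \<le> \<tau> l \<omega>) \<and>
    (AE \<omega> in P. \<phi> r (reward (Suc p) \<tau>) \<omega> = max (payoff T H r \<omega> + \<phi> r Z0 \<omega>) (\<phi> r Z1 \<omega>))"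
proof -
  have Z: "Z0 \<in> \<XX>" "Z1 \<in> \<XX>" using Z0 Z1 known_XX unfolding optimal_value_def by blast+
  obtain \<sigma>0 where \<sigma>0: "\<sigma>0 \<in> exercise_times P F T p (Suc r)" and ge0: "\<And>l \<omega>. Suc r \<le> \<sigma>0 l \<omega>"
    and opt0: "AE \<omega> in P. \<phi> (Suc r) (reward p \<sigma>0) \<omega> = Z0 \<omega>"
    using Z0 unfolding optimal_value_def by blast
  obtain \<sigma>1 where \<sigma>1: "\<sigma>1 \<in> exercise_times P F T (Suc p) (Suc r)" and ge1: "\<And>l \<omega>. Suc r \<le> \<sigma>1 l \<omega>"
    and opt1: "AE \<omega> in P. \<phi> (Suc r) (reward (Suc p) \<sigma>1) \<omega> = Z1 \<omega>"
    using Z1 unfolding optimal_value_def by blast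
  \<comment> \<open>the event must belong to the sigma-algebra at \<open>r\<close>, hence the comparison of measurable versions\<close>
  obtain V0 where V0: "V0 \<in> borel_measurable (\<FF> r)" "AE \<omega> in P. payoff T H r \<omega> + \<phi> r Z0 \<omega> = V0 \<omega>"
    using knownE[OF known_add[OF payoff_known phi_known[OF Z(1)]]] by metis
  obtain V1 where V1: "V1 \<in> borel_measurable (\<FF> r)" "AE \<omega> in P. \<phi> r Z1 \<omega> = V1 \<omega>"
    using knownE[OF phi_known[OF Z(2)]] by metis
  define A where "A = {\<omega> \<in> space (\<FF> r). V1 \<omega> \<le> V0 \<omega>}"
  have A: "A \<in> sets (\<FF> r)" unfolding A_def using V0(1) V1(1) by measurable
  have B: "space (\<FF> r) - A \<in> sets (\<FF> r)" using A by blast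
  define \<tau> where "\<tau> l \<omega> = (if \<omega> \<in> A then (if l \<le> 1 then r else \<sigma>0 (l - 1) \<omega>) else \<sigma>1 l \<omega>)" for l \<omega>
  have ge: "r \<le> \<tau> l \<omega>" for l \<omega>
    using ge0[of "l - 1" \<omega>] ge1[of l \<omega>] by (simp add: \<tau>_def)
  have \<tau>: "\<tau> \<in> exercise_times P F T (Suc p) r"
    unfolding exercise_times_def
  proof (intro CollectI conjI ballI allI impI)
    fix l assume l: "l \<in> {1..Suc p}"
    have "stopping_time \<FF> (\<lambda>\<omega>. if \<omega> \<in> A then (if l \<le> 1 then r else \<sigma>0 (l - 1) \<omega>) else \<sigma>1 l \<omega>)"
    proof (rule stopping_time_if[OF A])
      show "stopping_time \<FF> (\<lambda>\<omega>. if l \<le> 1 then r else \<sigma>0 (l - 1) \<omega>)"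
      proof (cases "l \<le> 1")
        case False
        then have "l - 1 \<in> {1..p}" using l by auto
        then have "stopping_time \<FF> (\<sigma>0 (l - 1))" using \<sigma>0 unfolding exercise_times_def by blast
        moreover have "(\<lambda>\<omega>. if l \<le> 1 then r else \<sigma>0 (l - 1) \<omega>) = \<sigma>0 (l - 1)"
          using False by (simp only: if_False)
        ultimately show ?thesis by (simp only:)
      qed (simp add: stopping_time_const)
      show "stopping_time \<FF> (\<sigma>1 l)" using \<sigma>1 l by (simp add: exercise_times_def)
      show "r \<le> (if l \<le> 1 then r else \<sigma>0 (l - 1) \<omega>)" for \<omega> using ge0[of "l - 1" \<omega>] by simp
      show "r \<le> \<sigma>1 l \<omega>" for \<omega> using ge1[of l \<omega>] by simp
    qed
    then show "stopping_time \<FF> (\<tau> l)" by (simp add: \<tau>_def[abs_def])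
  next
    show "AE \<omega> in P. r \<le> \<tau> 1 \<omega>" by (simp add: ge)
  next
    fix l assume l: "1 < l \<and> l \<le> Suc p"
    have ord1: "AE \<omega> in P. \<sigma>1 (l - 1) \<omega> + 1 \<le> \<sigma>1 l \<omega>"
      using \<sigma>1 l unfolding exercise_times_def by blast
    have ord0: "AE \<omega> in P. l \<noteq> 2 \<longrightarrow> \<sigma>0 (l - 2) \<omega> + 1 \<le> \<sigma>0 (l - 1) \<omega>"
    proof (cases "l = 2")
      case False
      then have l': "1 < l - 1 \<and> l - 1 \<le> p" "l - 1 - 1 = l - 2" using l by auto
      have "1 < l - 1 \<and> l - 1 \<le> p \<longrightarrow> (AE \<omega> in P. \<sigma>0 (l - 1 - 1) \<omega> + 1 \<le> \<sigma>0 (l - 1) \<omega>)"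
        using \<sigma>0 unfolding exercise_times_def by blast
      with l' have "AE \<omega> in P. \<sigma>0 (l - 2) \<omega> + 1 \<le> \<sigma>0 (l - 1) \<omega>" by (simp only: simp_thms)
      then show ?thesis by eventually_elim blast
    qed simp
    show "AE \<omega> in P. \<tau> (l - 1) \<omega> + 1 \<le> \<tau> l \<omega>"
      using ord0 ord1
    proof eventually_elim
      case (elim \<omega>)
      have l': "\<not> l \<le> 1" "l - 1 \<le> 1 \<longleftrightarrow> l = 2" "l - 1 - 1 = l - 2" using l by auto
      show ?case using elim ge0[of "l - 1" \<omega>] unfolding \<tau>_def l' using l' by (cases "\<omega> \<in> A"; cases "l = 2") simp_all
    qed
  qed

  have "AE \<omega> in P. \<omega> \<in> A \<longrightarrow>
      \<phi> r (reward (Suc p) \<tau>) \<omega> = \<phi> r (\<lambda>\<omega>. reward p \<sigma>0 \<omega> + payoff T H r \<omega>) \<omega>"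
  proof (intro phi_local reward_XX[OF \<tau>] X_add reward_XX[OF \<sigma>0] known_XX[OF payoff_known] A AE_I2 impI)
    fix \<omega> assume "\<omega> \<in> A"
    then show "reward (Suc p) \<tau> \<omega> = reward p \<sigma>0 \<omega> + payoff T H r \<omega>"
      using reward_cong[of p "\<lambda>l. \<tau> (Suc l)" \<omega> \<sigma>0] by (simp add: reward_Suc) (simp add: \<tau>_def)
  qed
  moreover have "AE \<omega> in P. \<phi> r (\<phi> (Suc r) (reward p \<sigma>0)) \<omega> = \<phi> r Z0 \<omega>"
    by (intro phi_cong phi_XX reward_XX[OF \<sigma>0] Z opt0)
  ultimately have onA: "AE \<omega> in P. \<omega> \<in> A \<longrightarrow> \<phi> r (reward (Suc p) \<tau>) \<omega> = payoff T H r \<omega> + \<phi> r Z0 \<omega>"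
    using phi_reward_now[OF \<sigma>0] by eventually_elim simp

  have "AE \<omega> in P. \<omega> \<in> space (\<FF> r) - A \<longrightarrow>
      \<phi> r (reward (Suc p) \<tau>) \<omega> = \<phi> r (reward (Suc p) \<sigma>1) \<omega>"
  proof (intro phi_local reward_XX[OF \<tau>] reward_XX[OF \<sigma>1] B AE_I2 impI)
    fix \<omega> assume "\<omega> \<in> space (\<FF> r) - A"
    then show "reward (Suc p) \<tau> \<omega> = reward (Suc p) \<sigma>1 \<omega>"
      by (intro reward_cong) (simp add: \<tau>_def)
  qed
  moreover have "AE \<omega> in P. \<phi> r (\<phi> (Suc r) (reward (Suc p) \<sigma>1)) \<omega> = \<phi> r Z1 \<omega>"
    by (intro phi_cong phi_XX reward_XX[OF \<sigma>1] Z opt1)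
  ultimately have onB: "AE \<omega> in P. \<omega> \<in> space (\<FF> r) - A \<longrightarrow> \<phi> r (reward (Suc p) \<tau>) \<omega> = \<phi> r Z1 \<omega>"
    using phi_tower_Suc[OF reward_XX[OF \<sigma>1], of r] by eventually_elim simp

  have "AE \<omega> in P. \<phi> r (reward (Suc p) \<tau>) \<omega> = max (payoff T H r \<omega> + \<phi> r Z0 \<omega>) (\<phi> r Z1 \<omega>)"
    using onA onB V0(2) V1(2) AE_space
    by eventually_elim (auto simp: A_def filt.space_F max_def)
  with \<tau> ge show ?thesis by blast
qed

lemma bellman_step:
  assumes Z0: "optimal_value p (Suc r) Z0" and Z1: "optimal_value (Suc p) (Suc r) Z1"
  shows "optimal_value (Suc p) r (\<lambda>\<omega>. max (payoff T H r \<omega> + \<phi> r Z0 \<omega>) (\<phi> r Z1 \<omega>))"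
proof -
  have Z: "Z0 \<in> \<XX>" "Z1 \<in> \<XX>" using Z0 Z1 known_XX unfolding optimal_value_def by blast+
  show ?thesis
    unfolding optimal_value_def using bellman_upper[OF assms] bellman_attained[OF assms]
    by (auto intro!: known_max known_add payoff_known phi_known Z)
qed

abbreviation Y :: "nat \<Rightarrow> nat \<Rightarrow> 'a \<Rightarrow> real" where "Y \<equiv> snell P F T \<rho> H"

text \<open>An upper bound that is attained by a member lies below every other upper bound.\<close>

lemma optimal_value_is_ess_sup:
  assumes Z: "optimal_value q r Z" and r: "r \<le> T"
  shows "is_ess_sup P (exercise_values P F T \<rho> H q r) (\<lambda>\<omega>. ereal (Z \<omega>))"
proof -
  have val: "exercise_values P F T \<rho> H q r = (\<lambda>\<tau>. \<phi> r (reward q \<tau>)) ` exercise_times P F T q r"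
    using r by (simp add: exercise_values_def freeze_def reward_def[abs_def] min_def)
  obtain \<tau> where \<tau>: "\<tau> \<in> exercise_times P F T q r" "AE \<omega> in P. \<phi> r (reward q \<tau>) \<omega> = Z \<omega>"
    using Z unfolding optimal_value_def by blast
  have "Z \<in> borel_measurable P" using Z XX_measurable known_XX unfolding optimal_value_def by blast
  then show ?thesis
    unfolding is_ess_sup_def val
  proof (intro conjI ballI impI)
    fix X assume "X \<in> (\<lambda>\<tau>. \<phi> r (reward q \<tau>)) ` exercise_times P F T q r"
    then show "AE \<omega> in P. ereal (X \<omega>) \<le> ereal (Z \<omega>)"
      using Z unfolding optimal_value_def by auto
  next
    fix Z' assume "\<forall>X\<in>(\<lambda>\<tau>. \<phi> r (reward q \<tau>)) ` exercise_times P F T q r. AE \<omega> in P. ereal (X \<omega>) \<le> Z' \<omega>"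
    then have "AE \<omega> in P. ereal (\<phi> r (reward q \<tau>) \<omega>) \<le> Z' \<omega>" using \<tau>(1) by blast
    with \<tau>(2) show "AE \<omega> in P. ereal (Z \<omega>) \<le> Z' \<omega>" by eventually_elim simp
  qed simp
qed

lemma snell_eq_optimal_value:
  assumes Z: "optimal_value q r Z" and "r \<le> T" "1 \<le> q"
  shows "Y q r \<in> borel_measurable P" "AE \<omega> in P. Y q r \<omega> = Z \<omega>"
proof -
  let ?S = "exercise_values P F T \<rho> H q r"
  have Y: "Y q r = (\<lambda>\<omega>. real_of_ereal (ess_sup P ?S \<omega>))"
    using assms by (simp add: snell_def)
  note sup = optimal_value_is_ess_sup[OF Z \<open>r \<le> T\<close>]
  then have sup': "is_ess_sup P ?S (ess_sup P ?S)" unfolding ess_sup_def by (rule someI[where P = "is_ess_sup P ?S"])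
  then have "ess_sup P ?S \<in> borel_measurable P" by (simp add: is_ess_sup_def)
  then show "Y q r \<in> borel_measurable P" unfolding Y by measurable
  show "AE \<omega> in P. Y q r \<omega> = Z \<omega>"
    using is_ess_sup_unique[OF sup sup'] unfolding Y
    by eventually_elim (metis real_of_ereal.simps(1))
qed

text \<open>Backward induction from \<open>T + 1\<close>, where all rewards vanish. In the step the essential supremum is
  identified with the maximum constructed from the two envelopes one period later.\<close>

lemma optimal_value_snell: "optimal_value q r (Y q r)"
proof (cases "r \<le> T")
  case False
  then have "Y q r = (\<lambda>_. 0)" by (simp add: snell_def)
  then show ?thesis using False by (simp add: optimal_value_worthless)
next
  case True
  have no_rights: "optimal_value 0 s (Y 0 s)" for s
    by (simp add: snell_def[abs_def] optimal_value_worthless)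
  have "r \<le> Suc T" using True by simp
  then show ?thesis
  proof (induction r arbitrary: q rule: inc_induct)
    case base
    have "Y q (Suc T) = (\<lambda>_. 0)" by (simp add: snell_def)
    then show ?case by (simp add: optimal_value_worthless)
  next
    case (step r)
    show ?case
    proof (cases q)
      case 0
      then show ?thesis using no_rights by simp
    next
      case (Suc p)
      have opt: "optimal_value q r (\<lambda>\<omega>. max (payoff T H r \<omega> + \<phi> r (Y p (Suc r)) \<omega>) (\<phi> r (Y q (Suc r)) \<omega>))"
        unfolding Suc by (intro bellman_step step.IH)
      have "r \<le> T" "1 \<le> q" using step Suc by auto
      note eq = snell_eq_optimal_value[OF opt this]
      show ?thesis
        by (rule optimal_value_cong[OF opt eq(1)]) (use eq(2) in eventually_elim, simp)
    qed
  qed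
qed

lemma snell_known: "Y q r \<in> known r"
  using optimal_value_snell unfolding optimal_value_def by blast

lemma snell_bellman:
  assumes "r \<le> T" "1 \<le> q"
  shows "AE \<omega> in P. Y q r \<omega> = max (H r \<omega> + \<phi> r (Y (q - 1) (Suc r)) \<omega>) (\<phi> r (Y q (Suc r)) \<omega>)"
proof -
  obtain p where q: "q = Suc p" using assms by (cases q) auto
  have payoff: "payoff T H r = H r" using assms by (simp add: payoff_def fun_eq_iff)
  have "AE \<omega> in P. Y (Suc p) r \<omega>
      = max (payoff T H r \<omega> + \<phi> r (Y p (Suc r)) \<omega>) (\<phi> r (Y (Suc p) (Suc r)) \<omega>)"
    by (rule snell_eq_optimal_value(2)[OF bellman_step[OF optimal_value_snell optimal_value_snell] assms(1)]) simp
  then show ?thesis unfolding q payoff diff_Suc_1 .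
qed

end

section \<open>Weak duality\<close>

context conditional_valuation
begin

lemma martingale_known: "M \<in> rho_martingales P F T \<XX> \<rho> \<Longrightarrow> freeze T M s \<in> known s"
  by (auto simp: rho_martingales_def adapted_processes_def known_def freeze_def)

end

context adapted_reward
begin

lemma path_value_XX:
  assumes M: "\<And>k. k \<in> {1..L} \<Longrightarrow> M k \<in> rho_martingales P F T \<XX> \<rho>"
  shows "path_value T L H M j \<in> \<XX>"
  unfolding path_value_def[abs_def]
  by (intro XX_sum XX_diff X_add known_XX[OF payoff_known] known_XX[OF martingale_known] M)

text \<open>Cutting the dates off at \<open>T + 1\<close> does not change the path values, so the maximum is taken over a
  finite set of date vectors that is the same for all \<open>\<omega>\<close>.\<close>

lemma pathwise_max_XX:
  assumes M: "\<And>k. k \<in> {1..L} \<Longrightarrow> M k \<in> rho_martingales P F T \<XX> \<rho>"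
  shows "pathwise_max T L H t M \<in> \<XX>"
proof -
  define cut where "cut j = restrict (\<lambda>k. min (j k) (T + 1)) {..L}" for j :: "nat \<Rightarrow> nat"
  define J where "J = cut ` exercise_dates L t"
  have "J \<subseteq> {..L} \<rightarrow>\<^sub>E {..T + 1}" by (auto simp: J_def cut_def PiE_iff extensional_def split: if_splits)
  then have fin: "finite J" by (rule finite_subset) (auto intro: finite_PiE)
  have "(\<lambda>j. path_value T L H M j \<omega>) ` exercise_dates L t = (\<lambda>j. path_value T L H M j \<omega>) ` J" for \<omega>
    unfolding J_def image_image cut_def path_value_truncate[symmetric] ..
  then have "pathwise_max T L H t M = (\<lambda>\<omega>. Max ((\<lambda>j. path_value T L H M j \<omega>) ` J))"
    by (simp add: pathwise_max_def fun_eq_iff)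
  also have "\<dots> \<in> \<XX>"
    using fin exercise_dates_nonempty[of L t]
    by (intro XX_Max path_value_XX M) (auto simp: J_def)
  finally show ?thesis .
qed

end

locale subadditive_valuation = conditional_valuation +
  assumes P1: "subadditive_functional P T \<XX> \<rho>"
begin

lemma phi_subadditive:
  "X \<in> \<XX> \<Longrightarrow> X' \<in> \<XX> \<Longrightarrow> AE \<omega> in P. \<phi> s (\<lambda>\<omega>. X \<omega> + X' \<omega>) \<omega> \<le> \<phi> s X \<omega> + \<phi> s X' \<omega>"
  using P1 unfolding subadditive_functional_def freeze_def by simp

lemma phi_sum_nonpos:
  assumes "finite I" "\<And>i. i \<in> I \<Longrightarrow> X i \<in> \<XX>" "\<And>i. i \<in> I \<Longrightarrow> AE \<omega> in P. \<phi> s (X i) \<omega> \<le> 0"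
  shows "AE \<omega> in P. \<phi> s (\<lambda>\<omega>. \<Sum>i\<in>I. X i \<omega>) \<omega> \<le> 0"
  using assms
proof (induction I rule: finite_induct)
  case empty
  show ?case using phi_zero[of s] by eventually_elim simp
next
  case (insert i I)
  have "AE \<omega> in P. \<phi> s (\<lambda>\<omega>. X i \<omega> + (\<Sum>i\<in>I. X i \<omega>)) \<omega> \<le> \<phi> s (X i) \<omega> + \<phi> s (\<lambda>\<omega>. \<Sum>i\<in>I. X i \<omega>) \<omega>"
    using insert.prems by (intro phi_subadditive XX_sum) auto
  moreover have "AE \<omega> in P. \<phi> s (X i) \<omega> \<le> 0" "AE \<omega> in P. \<phi> s (\<lambda>\<omega>. \<Sum>i\<in>I. X i \<omega>) \<omega> \<le> 0"
    using insert by auto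
  ultimately have "AE \<omega> in P. \<phi> s (\<lambda>\<omega>. X i \<omega> + (\<Sum>i\<in>I. X i \<omega>)) \<omega> \<le> 0" by eventually_elim simp
  then show ?case using insert.hyps by simp
qed

text \<open>Seen from \<open>s\<close>, the increment \<open>M (Suc s) - M s\<close> has value zero and the event is known; the tower
  property carries this back to \<open>t\<close>.\<close>

lemma martingale_increment:
  assumes M: "M \<in> rho_martingales P F T \<XX> \<rho>" and A: "A \<in> sets (\<FF> s)" and "t \<le> s" "s < T"
  shows "(\<lambda>\<omega>. indicator A \<omega> * (M (Suc s) \<omega> - M s \<omega>)) \<in> \<XX>"
    and "AE \<omega> in P. \<phi> t (\<lambda>\<omega>. indicator A \<omega> * (M (Suc s) \<omega> - M s \<omega>)) \<omega> = 0"
proof -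
  have eq: "freeze T M s = M s" "freeze T M (Suc s) = M (Suc s)" "\<phi> s = \<rho> s"
    using \<open>s < T\<close> by (simp_all add: freeze_def min_def)
  have Ms: "M s \<in> known s" and Ms': "M (Suc s) \<in> \<XX>"
    using martingale_known[OF M, of s] martingale_known[OF M, of "Suc s"] eq known_XX by simp_all
  have A': "A \<in> sets P" using A sets_FF_subset by blast
  let ?D = "\<lambda>\<omega>. M (Suc s) \<omega> - M s \<omega>"
  have D: "?D \<in> \<XX>" by (intro XX_diff Ms' known_XX[OF Ms])
  show X: "(\<lambda>\<omega>. indicator A \<omega> * ?D \<omega>) \<in> \<XX>" by (rule XX_indicator_mult[OF A' D])
  have "(\<lambda>\<omega>. - 1 * M s \<omega>) \<in> known s" by (rule known_scale[OF Ms])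
  from phi_translate[OF Ms' this] have "AE \<omega> in P. \<phi> s ?D \<omega> = \<phi> s (M (Suc s)) \<omega> - M s \<omega>" by simp
  moreover have "AE \<omega> in P. M s \<omega> = \<phi> s (M (Suc s)) \<omega>"
    using M \<open>s < T\<close> by (simp add: rho_martingales_def eq)
  ultimately have "AE \<omega> in P. \<phi> s (\<lambda>\<omega>. indicator A \<omega> * ?D \<omega>) \<omega> = 0"
    using phi_indicator_mult[OF D A] by eventually_elim simp
  then have "AE \<omega> in P. \<phi> t (\<phi> s (\<lambda>\<omega>. indicator A \<omega> * ?D \<omega>)) \<omega> = \<phi> t (\<lambda>_. 0) \<omega>"
    by (intro phi_cong phi_XX X XX_zero)
  with phi_tower[OF \<open>t \<le> s\<close> X] phi_zero[of t]
  show "AE \<omega> in P. \<phi> t (\<lambda>\<omega>. indicator A \<omega> * ?D \<omega>) \<omega> = 0" by eventually_elim simp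
qed

lemma martingale_stopped_XX:
  fixes \<sigma> :: "'a \<Rightarrow> nat"
  assumes "M \<in> rho_martingales P F T \<XX> \<rho>" "stopping_time \<FF> \<sigma>"
  shows "(\<lambda>\<omega>. freeze T M (\<sigma> \<omega>) \<omega>) \<in> \<XX>"
  by (rule stopped_XX[OF assms(2) known_XX[OF martingale_known[OF assms(1)]], where N = T])
     (simp add: freeze_def)

text \<open>The stopped increment is the sum of the one-step increments over all \<open>s\<close> with \<open>\<sigma> \<le> s < \<tau>\<close>, an
  event known at \<open>s\<close>. Subadditivity bounds the value of the sum by the sum of the values. For a
  nonlinear valuation only this inequality can be expected.\<close>

lemma optional_sampling:
  fixes \<sigma> \<tau> :: "'a \<Rightarrow> nat"
  assumes M: "M \<in> rho_martingales P F T \<XX> \<rho>"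
    and \<sigma>: "stopping_time \<FF> \<sigma>" and \<tau>: "stopping_time \<FF> \<tau>"
    and le: "AE \<omega> in P. t \<le> \<sigma> \<omega> \<and> \<sigma> \<omega> \<le> \<tau> \<omega>"
  shows "AE \<omega> in P. \<phi> t (\<lambda>\<omega>. freeze T M (\<tau> \<omega>) \<omega> - freeze T M (\<sigma> \<omega>) \<omega>) \<omega> \<le> 0"
proof -
  define A where "A s = {\<omega> \<in> space P. \<sigma> \<omega> \<le> s} \<inter> {\<omega> \<in> space P. s < \<tau> \<omega>}" for s
  have A: "A s \<in> sets (\<FF> s)" for s
    unfolding A_def by (intro sets.Int stopping_le stopping_gt \<sigma> \<tau>)
  note incr = martingale_increment[OF M A]
  let ?I = "\<lambda>s \<omega>. indicator (A s) \<omega> * (M (Suc s) \<omega> - M s \<omega>)"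
  have telescope: "freeze T M v \<omega> - freeze T M u \<omega>
      = (\<Sum>s=t..<T. if u \<le> s \<and> s < v then M (Suc s) \<omega> - M s \<omega> else 0)"
    if "t \<le> u" "u \<le> v" for u v \<omega>
    using \<open>u \<le> v\<close>
  proof (induction v rule: dec_induct)
    case base
    then show ?case by (simp add: sum.neutral)
  next
    case (step v)
    have "(\<Sum>s=t..<T. if u \<le> s \<and> s < Suc v then M (Suc s) \<omega> - M s \<omega> else 0)
        = (\<Sum>s=t..<T. (if u \<le> s \<and> s < v then M (Suc s) \<omega> - M s \<omega> else 0)
            + (if s = v then M (Suc v) \<omega> - M v \<omega> else 0))"
      using step.hyps by (intro sum.cong) auto
    also have "\<dots> = freeze T M v \<omega> - freeze T M u \<omega> + (if v < T then M (Suc v) \<omega> - M v \<omega> else 0)"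
      using step that by (simp add: sum.distrib)
    also have "\<dots> = freeze T M (Suc v) \<omega> - freeze T M u \<omega>"
      by (auto simp: freeze_def min_def not_less_eq_eq)
    finally show ?case by simp
  qed
  have "AE \<omega> in P. freeze T M (\<tau> \<omega>) \<omega> - freeze T M (\<sigma> \<omega>) \<omega> = (\<Sum>s=t..<T. ?I s \<omega>)"
    using le AE_space
  proof eventually_elim
    case (elim \<omega>)
    then have "freeze T M (\<tau> \<omega>) \<omega> - freeze T M (\<sigma> \<omega>) \<omega>
        = (\<Sum>s=t..<T. if \<sigma> \<omega> \<le> s \<and> s < \<tau> \<omega> then M (Suc s) \<omega> - M s \<omega> else 0)"
      by (intro telescope) auto
    also have "\<dots> = (\<Sum>s=t..<T. ?I s \<omega>)"
      using elim by (intro sum.cong) (auto simp: A_def indicator_def)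
    finally show ?case .
  qed
  then have "AE \<omega> in P. \<phi> t (\<lambda>\<omega>. freeze T M (\<tau> \<omega>) \<omega> - freeze T M (\<sigma> \<omega>) \<omega>) \<omega>
      = \<phi> t (\<lambda>\<omega>. \<Sum>s=t..<T. ?I s \<omega>) \<omega>"
    by (intro phi_cong XX_diff XX_sum martingale_stopped_XX[OF M] \<sigma> \<tau> incr(1)) auto
  moreover have "AE \<omega> in P. \<phi> t (\<lambda>\<omega>. \<Sum>s=t..<T. ?I s \<omega>) \<omega> \<le> 0"
  proof (rule phi_sum_nonpos)
    show "?I s \<in> \<XX>" if "s \<in> {t..<T}" for s using that by (intro incr(1)) auto
    show "AE \<omega> in P. \<phi> t (?I s) \<omega> \<le> 0" if "s \<in> {t..<T}" for s
      using incr(2)[of t s] that by (auto elim: eventually_mono)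
  qed simp
  ultimately show ?thesis by eventually_elim simp
qed

end

locale multiple_stopping = adapted_reward + subadditive_valuation
begin

text \<open>Along an optimal exercise vector the reward equals the path value plus the increments of the
  martingales between consecutive dates. The path value is at most the pathwise maximum, and by
  subadditivity and optional sampling the increments do not raise the value.\<close>

lemma weak_duality:
  assumes M: "\<And>k. k \<in> {1..L} \<Longrightarrow> M k \<in> rho_martingales P F T \<XX> \<rho>"
  shows "AE \<omega> in P. Y L t \<omega> \<le> \<phi> t (pathwise_max T L H t M) \<omega>"
proof -
  obtain \<tau> where \<tau>: "\<tau> \<in> exercise_times P F T L t"
    and opt: "AE \<omega> in P. \<phi> t (reward L \<tau>) \<omega> = Y L t \<omega>"
    using optimal_value_snell[of L t] unfolding optimal_value_def by blast
  \<comment> \<open>the convention \<open>j\<^sub>0 = t\<close> of the date vectors\<close>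
  define \<sigma> where "\<sigma> = \<tau>(0 := \<lambda>_. t)"
  have st: "stopping_time \<FF> (\<sigma> k)" if "k \<le> L" for k
    using \<tau> that by (auto simp: \<sigma>_def exercise_times_def stopping_time_const)
  have "AE \<omega> in P. \<forall>l\<in>{2..L}. \<tau> (l - 1) \<omega> + 1 \<le> \<tau> l \<omega>"
    using \<tau> by (intro AE_finite_allI) (auto simp: exercise_times_def)
  with exercise_times_chain[OF \<tau>]
  have dates: "AE \<omega> in P. (\<lambda>k. \<sigma> k \<omega>) \<in> exercise_dates L t"
  proof eventually_elim
    case (elim \<omega>)
    have "\<sigma> k \<omega> < \<sigma> (k + 1) \<omega>" if "1 \<le> k \<and> k < L" for k
      using bspec[OF elim(2), of "k + 1"] that by (simp add: \<sigma>_def)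
    then show ?case using elim(1) by (simp add: exercise_dates_def \<sigma>_def)
  qed
  have ordered: "AE \<omega> in P. t \<le> \<sigma> (k - 1) \<omega> \<and> \<sigma> (k - 1) \<omega> \<le> \<sigma> k \<omega>" if k: "k \<in> {1..L}" for k
    using dates exercise_times_chain[OF \<tau>]
  proof eventually_elim
    case (elim \<omega>)
    show ?case
    proof (cases "k = 1")
      case True
      then show ?thesis using elim(1) by (simp add: exercise_dates_def)
    next
      case False
      then have k': "1 \<le> k - 1" "k - 1 < L" "k - 1 + 1 = k" "k - 1 \<in> {1..L}" using k by auto
      then have "\<sigma> (k - 1) \<omega> < \<sigma> k \<omega>"
        using elim(1) unfolding exercise_dates_def by fastforce
      moreover have "\<tau> 1 \<omega> + (k - 1) \<le> \<tau> (k - 1) \<omega> + 1" using elim(2) k'(4) by blast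
      then have "t \<le> \<tau> (k - 1) \<omega>" using conjunct1[OF elim(2)] k'(1) by linarith
      moreover have "k - 1 \<noteq> 0" using k'(1) by linarith
      then have "\<sigma> (k - 1) = \<tau> (k - 1)" unfolding \<sigma>_def by (rule fun_upd_other)
      ultimately show ?thesis by simp
    qed
  qed
  let ?G = "\<lambda>k \<omega>. freeze T (M k) (\<sigma> k \<omega>) \<omega> - freeze T (M k) (\<sigma> (k - 1) \<omega>) \<omega>"
  have G: "?G k \<in> \<XX>" if "k \<in> {1..L}" for k
    using that by (intro XX_diff martingale_stopped_XX M st) auto
  have max: "pathwise_max T L H t M \<in> \<XX>"
    by (rule pathwise_max_XX[OF M])
  have "AE \<omega> in P. reward L \<tau> \<omega> \<le> pathwise_max T L H t M \<omega> + (\<Sum>k=1..L. ?G k \<omega>)"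
    using dates
  proof eventually_elim
    case (elim \<omega>)
    have "path_value T L H M (\<lambda>k. \<sigma> k \<omega>) \<omega> \<le> pathwise_max T L H t M \<omega>"
      unfolding pathwise_max_def by (intro Max_ge finite_path_values imageI elim)
    moreover have "reward L \<tau> \<omega> = path_value T L H M (\<lambda>k. \<sigma> k \<omega>) \<omega> + (\<Sum>k=1..L. ?G k \<omega>)"
      unfolding reward_def path_value_def sum.distrib[symmetric]
      by (intro sum.cong) (auto simp: \<sigma>_def)
    ultimately show ?case by simp
  qed
  then have "AE \<omega> in P. \<phi> t (reward L \<tau>) \<omega>
      \<le> \<phi> t (\<lambda>\<omega>. pathwise_max T L H t M \<omega> + (\<Sum>k=1..L. ?G k \<omega>)) \<omega>"
    by (intro phi_mono X_add max XX_sum G reward_XX[OF \<tau>])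
  moreover have "AE \<omega> in P. \<phi> t (\<lambda>\<omega>. pathwise_max T L H t M \<omega> + (\<Sum>k=1..L. ?G k \<omega>)) \<omega>
      \<le> \<phi> t (pathwise_max T L H t M) \<omega> + \<phi> t (\<lambda>\<omega>. \<Sum>k=1..L. ?G k \<omega>) \<omega>"
    by (intro phi_subadditive max XX_sum G)
  moreover have "AE \<omega> in P. \<phi> t (\<lambda>\<omega>. \<Sum>k=1..L. ?G k \<omega>) \<omega> \<le> 0"
  proof (rule phi_sum_nonpos[OF _ G])
    show "AE \<omega> in P. \<phi> t (?G k) \<omega> \<le> 0" if k: "k \<in> {1..L}" for k
    proof (rule optional_sampling[OF M[OF k] st st ordered[OF k]])
      show "k - 1 \<le> L" "k \<le> L" using k by auto
    qed
  qed auto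
  ultimately show ?thesis using opt by eventually_elim simp
qed

end

section \<open>The martingales of the envelopes\<close>

text \<open>Here \<open>y q s\<close> is the envelope on a fixed path, \<open>c q s\<close> the value of continuing with \<open>q\<close> rights
  after time \<open>s\<close>, and \<open>m q\<close> the martingale part of \<open>y q\<close>. Between two times at which
  \<open>q\<close> rights are left, the envelope rises by at most the martingale increment, and an exercise
  yields the payoff and \<open>c q\<close>, together at most \<open>y (Suc q)\<close>. By induction the terms
  of the first \<open>n\<close> exercises together with the continuation value with \<open>L - n\<close> rights stay below \<open>y L t\<close>. The continuation value, rather than the envelope,
  has to be carried along, because the next date must be strictly later.\<close>

lemma multiple_stopping_pathwise_bound:
  fixes y c m :: "nat \<Rightarrow> nat \<Rightarrow> real" and h :: "nat \<Rightarrow> real"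
  assumes stop: "\<And>q s. q < L \<Longrightarrow> h s + c q s \<le> y (Suc q) s"
    and continue: "\<And>q s. 1 \<le> q \<Longrightarrow> q \<le> L \<Longrightarrow> c q s \<le> y q s"
    and m: "\<And>q s. 1 \<le> q \<Longrightarrow> q \<le> L \<Longrightarrow> c q s = y q (Suc s) - (m q (Suc s) - m q s)"
    and none: "\<And>s. c 0 s = 0"
    and L: "1 \<le> L" and j: "j \<in> exercise_dates L t"
  shows "(\<Sum>k=1..L. h (j k) + m (L - k + 1) (j (k - 1)) - m (L - k + 1) (j k)) \<le> y L t"
proof -
  have wait: "y q u + m q s - m q u \<le> y q s" if "1 \<le> q" "q \<le> L" "s \<le> u" for q s u
    using \<open>s \<le> u\<close>
  proof (induction u rule: dec_induct)
    case (step u)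
    then show ?case using continue[of q u] m[of q u] that by simp
  qed simp
  have "(\<Sum>k=1..n. h (j k) + m (L - k + 1) (j (k - 1)) - m (L - k + 1) (j k)) + c (L - n) (j n) \<le> y L t"
    if "1 \<le> n" "n \<le> L" for n
    using that
  proof (induction n rule: dec_induct)
    case base
    have "j 0 = t" "t \<le> j 1" using j by (auto simp: exercise_dates_def)
    moreover have "Suc (L - 1) = L" using L by simp
    ultimately show ?case using wait[of L t "j 1"] stop[of "L - 1" "j 1"] L by simp
  next
    case (step n)
    define q where "q = L - Suc n"
    have q: "L - n = Suc q" "q < L" using step.prems by (auto simp: q_def)
    have "Suc (j n) \<le> j (Suc n)"
      using j step by (auto simp: exercise_dates_def)
    from wait[OF _ _ this, of "Suc q"] have
      "h (j (Suc n)) + m (Suc q) (j n) - m (Suc q) (j (Suc n)) + c q (j (Suc n)) \<le> c (Suc q) (j n)"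
      using q m[of "Suc q" "j n"] stop[of q "j (Suc n)"] by simp
    moreover have "(\<Sum>k=1..n. h (j k) + m (L - k + 1) (j (k - 1)) - m (L - k + 1) (j k)) + c (Suc q) (j n) \<le> y L t"
      using step q by simp
    ultimately show ?case using q by (simp add: q_def[symmetric])
  qed
  from this[of L] show ?thesis using L none by simp
qed

context adapted_reward
begin

abbreviation Mstar :: "nat \<Rightarrow> nat \<Rightarrow> 'a \<Rightarrow> real" where "Mstar \<equiv> snell_martingale P F T \<rho> H"

lemma snell_XX: "Y q r \<in> \<XX>"
  by (rule known_XX[OF snell_known])

lemma Mstar_known: "s \<le> T \<Longrightarrow> Mstar q s \<in> known s"
proof (induction s)
  case 0
  show ?case by (simp add: known_zero)
next
  case (Suc s)
  have "\<phi> s = \<rho> s" using Suc.prems by (simp add: freeze_def min_def)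
  then have "\<rho> s (Y q (Suc s)) \<in> known s" using phi_known[OF snell_XX, of s] by simp
  then have "\<rho> s (Y q (Suc s)) \<in> known (Suc s)" by (rule known_mono[rotated]) simp
  moreover have "Mstar q s \<in> known (Suc s)" using Suc by (intro known_mono[of s "Suc s"]) auto
  ultimately show ?case using snell_known[of q "Suc s"] by (simp add: known_add known_diff)
qed

lemma Mstar_martingale: "Mstar q \<in> rho_martingales P F T \<XX> \<rho>"
  unfolding rho_martingales_def adapted_processes_def
proof (intro CollectI conjI allI impI)
  show "Mstar q s \<in> \<XX> \<inter> L0 P (F s)" if "s \<le> T" for s
    using Mstar_known[OF that, of q] that by (simp add: known_def freeze_def min_def)
  fix s assume "s < T"
  then have \<phi>: "\<phi> s = \<rho> s" by (simp add: freeze_def min_def)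
  have "(\<lambda>\<omega>. Mstar q s \<omega> - \<rho> s (Y q (Suc s)) \<omega>) \<in> known s"
    using \<open>s < T\<close> phi_known[OF snell_XX, of s] unfolding \<phi> by (intro known_diff Mstar_known) auto
  from phi_translate[OF snell_XX this, of q "Suc s"]
  have "AE \<omega> in P. Mstar q s \<omega> = \<rho> s (\<lambda>\<omega>. Y q (Suc s) \<omega> + (Mstar q s \<omega> - \<rho> s (Y q (Suc s)) \<omega>)) \<omega>"
    unfolding \<phi> by eventually_elim simp
  moreover have "Mstar q (s + 1) = (\<lambda>\<omega>. Y q (Suc s) \<omega> + (Mstar q s \<omega> - \<rho> s (Y q (Suc s)) \<omega>))"
    by (simp add: fun_eq_iff)
  ultimately show "AE \<omega> in P. Mstar q s \<omega> = \<rho> s (Mstar q (s + 1)) \<omega>" by (simp only:)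
qed

lemma Mstar_martingale0: "Mstar q \<in> rho_martingales0 P F T \<XX> \<rho>"
  by (simp add: rho_martingales0_def Mstar_martingale)

text \<open>The Bellman principle consists of finitely many equations, which hold simultaneously outside a null
  set; on each remaining path the bound is a statement about real numbers.\<close>

lemma pathwise_max_le_snell:
  assumes "1 \<le> L"
  shows "AE \<omega> in P. pathwise_max T L H t (\<lambda>k. Mstar (L - k + 1)) \<omega> \<le> Y L t \<omega>"
proof -
  have "AE \<omega> in P. \<forall>r\<in>{..T}. \<forall>q\<in>{1..L}.
      Y q r \<omega> = max (H r \<omega> + \<phi> r (Y (q - 1) (Suc r)) \<omega>) (\<phi> r (Y q (Suc r)) \<omega>)"
    by (intro AE_finite_allI snell_bellman) auto
  moreover have "AE \<omega> in P. \<forall>q\<in>{..L}. \<phi> T (Y q (Suc T)) \<omega> = 0"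
    using phi_zero[of T] by (intro AE_finite_allI) (simp_all add: snell_def[abs_def])
  moreover have "AE \<omega> in P. \<forall>r\<in>{..T}. \<phi> r (Y 0 (Suc r)) \<omega> = 0"
    using phi_zero by (intro AE_finite_allI) (simp_all add: snell_def[abs_def])
  ultimately show ?thesis
  proof eventually_elim
    case (elim \<omega>)
    \<comment> \<open>The martingales are constant beyond the horizon, so continuing is worth zero from \<open>T\<close> on.\<close>
    let ?c = "\<lambda>q s. if s < T then \<phi> s (Y q (Suc s)) \<omega> else 0"
    have late: "Y q s = (\<lambda>_. 0)" if "T < s" for q s using that by (simp add: snell_def)
    have bellman: "Y q s \<omega> = max (payoff T H s \<omega> + ?c (q - 1) s) (?c q s)" if "1 \<le> q" "q \<le> L" for q s
    proof -
      consider "s < T" | "s = T" | "T < s" by linarith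
      then show ?thesis
      proof cases
        case 1
        then show ?thesis using elim(1) that by (simp add: payoff_def)
      next
        case 2
        then show ?thesis using elim(1,2) that by (simp add: payoff_def)
      next
        case 3
        then show ?thesis by (simp add: payoff_def late)
      qed
    qed
    have "path_value T L H (\<lambda>k. Mstar (L - k + 1)) j \<omega> \<le> Y L t \<omega>" if j: "j \<in> exercise_dates L t" for j
      unfolding path_value_def
    proof (rule multiple_stopping_pathwise_bound[where c = ?c and m = "\<lambda>q s. freeze T (Mstar q) s \<omega>"
          and h = "\<lambda>s. payoff T H s \<omega>" and y = "\<lambda>q s. Y q s \<omega>", OF _ _ _ _ assms j])
      show "payoff T H s \<omega> + ?c q s \<le> Y (Suc q) s \<omega>" if "q < L" for q s
        using bellman[of "Suc q" s] that by simp
      show "?c q s \<le> Y q s \<omega>" if "1 \<le> q" "q \<le> L" for q s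
        using bellman[OF that, of s] by simp
      show "?c q s = Y q (Suc s) \<omega> - (freeze T (Mstar q) (Suc s) \<omega> - freeze T (Mstar q) s \<omega>)"
        if "1 \<le> q" "q \<le> L" for q s
        by (cases "s < T") (simp_all add: freeze_def min_def late)
      show "?c 0 s = 0" for s using elim(3) by simp
    qed
    then show ?case
      unfolding pathwise_max_def using exercise_dates_nonempty[of L t]
      by (intro Max.boundedI finite_path_values) auto
  qed
qed

end

section \<open>The dual representation\<close>

context multiple_stopping
begin

text \<open>Monotonicity turns the pathwise bound into a bound on the value, because the envelope is known at
  \<open>t\<close> and equals its own value; weak duality is the reverse inequality.\<close>

lemma dual_attained:
  assumes "1 \<le> L"
  shows "AE \<omega> in P. Y L t \<omega> = \<phi> t (pathwise_max T L H t (\<lambda>k. Mstar (L - k + 1))) \<omega>"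
proof -
  let ?Z = "pathwise_max T L H t (\<lambda>k. Mstar (L - k + 1))"
  have "AE \<omega> in P. \<phi> t ?Z \<omega> \<le> \<phi> t (Y L t) \<omega>"
    by (intro phi_mono pathwise_max_le_snell[OF assms] snell_XX
        pathwise_max_XX[OF Mstar_martingale])
  moreover have "AE \<omega> in P. Y L t \<omega> \<le> \<phi> t ?Z \<omega>"
    by (intro weak_duality Mstar_martingale)
  ultimately show ?thesis using phi_of_known[OF snell_known[of L t]] by eventually_elim simp
qed

lemma dual_is_ess_inf:
  assumes "1 \<le> L"
  shows "is_ess_inf P
    {\<phi> t (pathwise_max T L H t M) | M. \<forall>k\<in>{1..L}. M k \<in> rho_martingales0 P F T \<XX> \<rho>}
    (\<lambda>\<omega>. ereal (Y L t \<omega>))"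
  unfolding is_ess_inf_def
proof (intro conjI ballI impI)
  show "(\<lambda>\<omega>. ereal (Y L t \<omega>)) \<in> borel_measurable P"
    using XX_measurable[OF snell_XX] by measurable
next
  fix X assume "X \<in> {\<phi> t (pathwise_max T L H t M) | M. \<forall>k\<in>{1..L}. M k \<in> rho_martingales0 P F T \<XX> \<rho>}"
  then obtain M where "X = \<phi> t (pathwise_max T L H t M)" "\<forall>k\<in>{1..L}. M k \<in> rho_martingales0 P F T \<XX> \<rho>"
    by blast
  then show "AE \<omega> in P. ereal (Y L t \<omega>) \<le> ereal (X \<omega>)" using weak_duality[of L M t] by (simp add: rho_martingales0_def)
next
  fix Z' assume "\<forall>X\<in>{\<phi> t (pathwise_max T L H t M) | M. \<forall>k\<in>{1..L}. M k \<in> rho_martingales0 P F T \<XX> \<rho>}.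
    AE \<omega> in P. Z' \<omega> \<le> ereal (X \<omega>)"
  then have "AE \<omega> in P. Z' \<omega> \<le> ereal (\<phi> t (pathwise_max T L H t (\<lambda>k. Mstar (L - k + 1))) \<omega>)"
    using Mstar_martingale0 by blast
  with dual_attained[OF assms, of t] show "AE \<omega> in P. Z' \<omega> \<le> ereal (Y L t \<omega>)"
    by eventually_elim simp
qed

text \<open>The difference of the pathwise maximum and the envelope is nonpositive, and its value is zero by
  translation invariance and \<open>dual_attained\<close>.\<close>

lemma dual_pathwise:
  assumes "1 \<le> L" and sensitive: "sensitive_functional P T \<XX> \<rho>"
  shows "AE \<omega> in P. Y L t \<omega> = pathwise_max T L H t (\<lambda>k. Mstar (L - k + 1)) \<omega>"
proof -
  let ?Z = "pathwise_max T L H t (\<lambda>k. Mstar (L - k + 1))"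
  let ?D = "\<lambda>\<omega>. ?Z \<omega> - Y L t \<omega>"
  have Z: "?Z \<in> \<XX>" by (rule pathwise_max_XX[OF Mstar_martingale])
  have "(\<lambda>\<omega>. - 1 * Y L t \<omega>) \<in> known t" by (rule known_scale[OF snell_known])
  from phi_translate[OF Z this] dual_attained[OF assms(1), of t]
  have "AE \<omega> in P. \<phi> t ?D \<omega> \<ge> 0" by eventually_elim simp
  moreover have "AE \<omega> in P. ?D \<omega> \<le> 0" using pathwise_max_le_snell[OF assms(1), of t] by eventually_elim simp
  moreover have "?D \<in> \<XX>" by (intro XX_diff Z snell_XX)
  ultimately have "AE \<omega> in P. ?D \<omega> = 0"
    using sensitive unfolding sensitive_functional_def freeze_def by (meson min.cobounded2)
  then show ?thesis by eventually_elim simp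
qed

end

theorem theorem3p1:
  fixes P :: "'a measure"
    and F :: "nat \<Rightarrow> 'a measure"
    and T L t :: nat
    and \<XX> :: "('a \<Rightarrow> real) set"
    and \<rho> :: "nat \<Rightarrow> ('a \<Rightarrow> real) \<Rightarrow> ('a \<Rightarrow> real)"
    and H :: "nat \<Rightarrow> 'a \<Rightarrow> real"
  assumes setting: "dynamic_setting P F T \<XX> \<rho>"
    and C1: "monotone_functional P T \<XX> \<rho>"
    and C2: "local_functional P F T \<XX> \<rho>"
    and C3: "time_consistent_functional P T \<XX> \<rho>"
    and C4: "translation_invariant_functional P F T \<XX> \<rho>"
    and P1: "subadditive_functional P T \<XX> \<rho>"
    and L: "L \<ge> 1"
    and H: "H \<in> adapted_processes P F T \<XX>"
    and t: "t \<le> T"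
  shows
    "let Y = snell P F T \<rho> H; Mstar = snell_martingale P F T \<rho> H in
      \<comment> \<open>the envelopes are well-defined, finite and satisfy the Bellman principle\<close>
      (\<forall>q\<in>{1..L}. Y q \<in> adapted_processes P F T \<XX>) \<and>
      (\<forall>q\<in>{1..L}. \<forall>r\<le>T.
         is_ess_sup P (exercise_values P F T \<rho> H q r) (\<lambda>\<omega>. ereal (Y q r \<omega>))) \<and>
      (\<forall>q\<in>{1..L}. \<forall>r\<le>T. AE \<omega> in P.
         Y q r \<omega> = max (H r \<omega> + \<rho> r (Y (q - 1) (r + 1)) \<omega>) (\<rho> r (Y q (r + 1)) \<omega>)) \<and>
      (\<forall>q\<in>{1..L}. Mstar q \<in> rho_martingales0 P F T \<XX> \<rho>) \<and>
      \<comment> \<open>(i)\<close>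
      is_ess_inf P
        {\<rho> t (pathwise_max T L H t M) | M. \<forall>k\<in>{1..L}. M k \<in> rho_martingales0 P F T \<XX> \<rho>}
        (\<lambda>\<omega>. ereal (Y L t \<omega>)) \<and>
      \<comment> \<open>(ii)\<close>
      (AE \<omega> in P. Y L t \<omega> = \<rho> t (pathwise_max T L H t (\<lambda>k. Mstar (L - k + 1))) \<omega>) \<and>
      \<comment> \<open>(iii)\<close>
      (sensitive_functional P T \<XX> \<rho> \<longrightarrow>
        (AE \<omega> in P. Y L t \<omega> = pathwise_max T L H t (\<lambda>k. Mstar (L - k + 1)) \<omega>))"
proof -
  interpret dynamic_setting P F T \<XX> \<rho> by (rule setting)
  interpret multiple_stopping P F T \<XX> \<rho> H
    by unfold_locales (fact C1 C2 C3 C4 H P1)+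
  have \<phi>: "\<phi> r = \<rho> r" if "r \<le> T" for r using that by (simp add: freeze_def min_def)
  have "Y q \<in> adapted_processes P F T \<XX>" for q
    using snell_known[of q] by (auto simp: adapted_processes_def known_def freeze_def min_def split: if_splits) metis+
  moreover have "is_ess_sup P (exercise_values P F T \<rho> H q r) (\<lambda>\<omega>. ereal (Y q r \<omega>))" if "r \<le> T" for q r
    by (rule optimal_value_is_ess_sup[OF optimal_value_snell that])
  moreover have "AE \<omega> in P. Y q r \<omega> = max (H r \<omega> + \<rho> r (Y (q - 1) (r + 1)) \<omega>) (\<rho> r (Y q (r + 1)) \<omega>)"
    if "r \<le> T" "q \<in> {1..L}" for q r
    using snell_bellman[of r q] that \<phi>[of r] by simp
  moreover note Mstar_martingale0 dual_is_ess_inf[OF L, of t, unfolded \<phi>[OF t]]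
    dual_attained[OF L, of t, unfolded \<phi>[OF t]] dual_pathwise[OF L, of t]
  ultimately show ?thesis unfolding Let_def by blast
qed

end
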